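(* Let $f:\mathbb{R}^n\to\mathbb{R}$ be $L$-smooth, possibly nonconvex, with lower curvature constant $l\in(0,L]$, and with a minimizer $x^*$. Let $\varepsilon>0$, let $x^0\in\mathbb{R}^n$ with $\|\nabla f(x^0)\|>\varepsilon$, and let $0<l_0\le l$ and $0<M_0\le4L$. Then the algorithm $\mathrm{NASCAR}(x^0,\varepsilon,l_0,M_0)$ (described in the context) outputs an approximate solution $\hat x$ such that $\|\nabla f(\hat x)\|\le\varepsilon$. The total number of gradient evaluations of $\nabla f$ required by the algorithm is bounded by $$8\sqrt{10}\,C_1\sqrt{\frac{L}{l_0}}\,\log_2\frac{4\|\nabla f(x^0)\|}{\varepsilon}+160\sqrt{10}\,C_1\,\frac{\sqrt{Ll}\,(f(x^0)-f(x^* ))}{\varepsilon^2},$$ where $C_1:=\sqrt2\,(3+16\sqrt{2c_{\mathcal A}})$.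
   Context: $\|\cdot\|$ is the Euclidean norm. $L$-smooth means differentiable with $\|\nabla f(x)-\nabla f(y)\|\le L\|x-y\|$ for all $x,y$. $f$ has lower curvature $l$ if $x\mapsto f(x)+\frac l2\|x\|^2$ is convex. Backtracking$(g,\sigma,x,M_0)$: for $j=0,1,\dots$ set $x^{++}=x-\frac{1}{2(M_j+\sigma)}\nabla g(x)$; if $g(x^{++})-g(x)-\langle\nabla g(x),x^{++}-x\rangle\le\frac{M_j+\sigma}{2}\|x^{++}-x\|^2$, terminate and return $M=M_j$; otherwise set $M_{j+1}=2M_j$. (Only one gradient, at $x$, is used.) AR method $(\hat x,M)=\mathrm{AR}(h,x_0,\sigma_1,M_0)$ for a smooth function $h$: set $\overline{x}_0=x_0$, $\sigma_0=0$. For $s=1,2,\dots$: if $s>1$ set $\sigma_s=4\sigma_{s-1}$; set $\overline{x}_s=(1-\gamma_s)\overline{x}_{s-1}+\gamma_sx_{s-1}$ with $\gamma_s=1-\sigma_{s-1}/\sigma_s$; run a subroutine $x_s=\mathcal{A}(h,\sigma_s,\overline{x}_s,x_{s-1})$ intended to approximate $x_s^*:=\operatorname{argmin}_{x\in\mathbb{R}^n}\{h_s(x):=h(x)+\frac{\sigma_s}{2}\|x-\overline{x}_s\|^2\}$; set $M_s=\text{Backtracking}(h_s,\sigma_s,x_s,M_{s-1}/2)$; if $\sigma_s\ge M_s$, terminate with $\hat x=x_s$, $M=M_s$. Assumption on the subroutine $\mathcal{A}$, applied to an $L_h$-smooth function $h$ (possibly nonconvex): after its $k$-th gradient evaluation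 of $\nabla h$ it has computed a point $x_s^k$ and an estimate $L_s^k\le c_{\mathcal A}L_h$, where $c_{\mathcal A}$ is a universal constant depending on $\mathcal{A}$; if moreover $h$ is convex, then $h_s(x_s^k)-h_s(x_s^* )\le\frac{L_s^k}{k^2}\|x_{s-1}-x_s^*\|^2$. It terminates whenever $k\ge8\sqrt{2L_s^k/\sigma_s}$ and outputs $x_s=x_s^k$. SCAR-PM: $(\hat x,\hat M,\mathrm{ERROR})=\text{SCAR-PM}(h,\epsilon',y_0,\tilde\mu,M_0)$: for $t=1,2,\dots$: set $(y_t,M_t)=\mathrm{AR}(h,y_{t-1},\tilde\mu/10,M_{t-1})$; if $\|\nabla h(y_t)\|\le\epsilon'$, terminate with $\hat x=y_t$, $\hat M=M_t$, ERROR = FALSE; otherwise, if $\|\nabla h(y_t)\|>\|\nabla h(y_{t-1})\|/2$, terminate with $\hat x=y_0$, $\hat M=M_t$, ERROR = TRUE. NASCAR: $\hat x=\mathrm{NASCAR}(x^0,\varepsilon,l_0,M_0)$: for $i=1,2,\dots$: set $F^{(i)}(x):=f(x)+l_{i-1}\|x-x^{i-1}\|^2$; set $(x^i,M_i,\mathrm{ERROR}_i)=\text{SCAR-PM}(F^{(i)},\varepsilon/4,x^{i-1},l_{i-1},M_{i-1})$; if $\|\nabla f(x^i)\|\le\varepsilon$, terminate with $\hat x=x^i$; if $\mathrm{ERROR}_i$ = TRUE or $\|\nabla f(x^i)\|^2>10\,l_{i-1}(f(x^{i-1})-f(x^i))$, set $l_i=4l_{i-1}$ and reset $x^i=x^{i-1}$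 (otherwise $l_i=l_{i-1}$). *)

theory Defs
  imports "HOL-Analysis.Analysis" "HOL-Library.Monad_Syntax"
begin

definition grad :: "('a::euclidean_space \<Rightarrow> real) \<Rightarrow> 'a \<Rightarrow> 'a" where
  "grad f x = (THE D. GDERIV f x :> D)"

definition smooth :: "real \<Rightarrow> ('a::euclidean_space \<Rightarrow> real) \<Rightarrow> bool" where
  "smooth L f \<longleftrightarrow>
     (\<forall>x. f differentiable (at x)) \<and>
     (\<forall>x y. norm (grad f x - grad f y) \<le> L * norm (x - y))"

definition lower_curvature :: "real \<Rightarrow> ('a::euclidean_space \<Rightarrow> real) \<Rightarrow> bool" where
  "lower_curvature l f \<longleftrightarrow> convex_on UNIV (\<lambda>x. f x + l / 2 * (norm x)\<^sup>2)"

definition regularized :: "('a::euclidean_space \<Rightarrow> real) \<Rightarrow> real \<Rightarrow> 'a \<Rightarrow> 'a \<Rightarrow> real" where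
  "regularized h \<sigma> c x = h x + \<sigma> / 2 * (norm (x - c))\<^sup>2"

text \<open>
  Loops are partial functions in the option monad: the value \<^term>\<open>None\<close> stands for
  nontermination. The \<^typ>\<open>nat\<close> component of a result is the number of gradient evaluations
  made so far. Every objective occurring below is \<open>f\<close> plus explicit quadratics, so
  evaluating its gradient costs exactly one evaluation of the gradient of \<open>f\<close>.
\<close>

text \<open>
  All trial steps use the same gradient, at \<open>x\<close>; a call costs one gradient evaluation, which
  is charged by the caller.
\<close>

partial_function (option) backtracking ::
    "('a::euclidean_space \<Rightarrow> real) \<Rightarrow> real \<Rightarrow> 'a \<Rightarrow> real \<Rightarrow> real option" where
  "backtracking g \<sigma> x M =
     (let y = x - (1 / (2 * (M + \<sigma>))) *\<^sub>R grad g x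
      in if g y - g x - grad g x \<bullet> (y - x) \<le> (M + \<sigma>) / 2 * (norm (y - x))\<^sup>2
         then Some M
         else backtracking g \<sigma> x (2 * M))"

text \<open>
  A subroutine maps \<open>h\<close>, \<open>\<sigma>\<^sub>s\<close>, the prox center, the starting point \<open>x\<^sub>s\<^sub>-\<^sub>1\<close> and \<open>k\<close> to the pair
  of the point and the estimate it has computed after its \<open>k\<close>-th evaluation of the gradient
  of \<open>h\<close>. Values beyond the first \<open>k\<close> that meets the stopping test are never used.
\<close>

type_synonym 'a subroutine =
  "('a \<Rightarrow> real) \<Rightarrow> real \<Rightarrow> 'a \<Rightarrow> 'a \<Rightarrow> nat \<Rightarrow> 'a \<times> real"

definition subroutine_assumption :: "real \<Rightarrow> ('a::euclidean_space) subroutine \<Rightarrow> bool" where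
  "subroutine_assumption c A \<longleftrightarrow>
     (\<forall>h Lh \<sigma> xbar x0 k xk Lk.
        smooth Lh h \<longrightarrow> \<sigma> > 0 \<longrightarrow> k \<ge> 1 \<longrightarrow> A h \<sigma> xbar x0 k = (xk, Lk) \<longrightarrow>
          Lk \<le> c * Lh \<and>
          (convex_on UNIV h \<longrightarrow>
             (\<forall>z. is_arg_min (regularized h \<sigma> xbar) (\<lambda>_. True) z \<longrightarrow>
                regularized h \<sigma> xbar xk - regularized h \<sigma> xbar z
                  \<le> Lk / (real k)\<^sup>2 * (norm (x0 - z))\<^sup>2)))"

partial_function (option) run_subroutine_from ::
    "nat \<Rightarrow> ('a::euclidean_space) subroutine \<Rightarrow> ('a \<Rightarrow> real) \<Rightarrow> real \<Rightarrow> 'a \<Rightarrow> 'a \<Rightarrow> ('a \<times> nat) option" where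
  "run_subroutine_from k A h \<sigma> xbar x0 =
     (let (xk, Lk) = A h \<sigma> xbar x0 k
      in if real k \<ge> 8 * sqrt (2 * Lk / \<sigma>)
         then Some (xk, k)
         else run_subroutine_from (k + 1) A h \<sigma> xbar x0)"

definition run_subroutine ::
    "('a::euclidean_space) subroutine \<Rightarrow> ('a \<Rightarrow> real) \<Rightarrow> real \<Rightarrow> 'a \<Rightarrow> 'a \<Rightarrow> ('a \<times> nat) option" where
  "run_subroutine = run_subroutine_from 1"

text \<open>
  In round \<open>s\<close> the arguments are \<open>\<sigma>\<^sub>s\<^sub>-\<^sub>1\<close>, \<open>\<sigma>\<^sub>s\<close>, the previous prox center, \<open>x\<^sub>s\<^sub>-\<^sub>1\<close>, \<open>M\<^sub>s\<^sub>-\<^sub>1\<close>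
  and the evaluations made in the earlier rounds.
\<close>

partial_function (option) AR_loop ::
    "('a::euclidean_space) subroutine \<Rightarrow> ('a \<Rightarrow> real) \<Rightarrow> real \<Rightarrow> real \<Rightarrow> 'a \<Rightarrow> 'a \<Rightarrow> real \<Rightarrow> nat
       \<Rightarrow> ('a \<times> real \<times> nat) option" where
  "AR_loop A h \<sigma>' \<sigma> xbar' x' M' N =
     (let \<gamma> = 1 - \<sigma>' / \<sigma>;
          xbar = (1 - \<gamma>) *\<^sub>R xbar' + \<gamma> *\<^sub>R x'
      in do {
           (x, k) \<leftarrow> run_subroutine A h \<sigma> xbar x';
           M \<leftarrow> backtracking (regularized h \<sigma> xbar) \<sigma> x (M' / 2);
           if \<sigma> \<ge> M
           then Some (x, M, N + k + 1)
           else AR_loop A h \<sigma> (4 * \<sigma>) xbar x M (N + k + 1)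
         })"

definition AR ::
    "('a::euclidean_space) subroutine \<Rightarrow> ('a \<Rightarrow> real) \<Rightarrow> 'a \<Rightarrow> real \<Rightarrow> real \<Rightarrow> ('a \<times> real \<times> nat) option" where
  "AR A h x0 \<sigma>1 M0 = AR_loop A h 0 \<sigma>1 x0 x0 M0 0"

text \<open>
  The stopping tests of the two outer methods are charged as well: one evaluation for each of
  \<open>y\<^sub>0\<close>, \<open>y\<^sub>1\<close>, \<dots> in SCAR-PM and one per iteration of NASCAR. Gradients computed earlier, by
  backtracking say, are not assumed to be reused, so the count is an upper bound for any
  implementation that does reuse them. The \<^typ>\<open>bool\<close> component is the ERROR flag.
\<close>

partial_function (option) SCAR_PM_loop ::
    "('a::euclidean_space) subroutine \<Rightarrow> ('a \<Rightarrow> real) \<Rightarrow> real \<Rightarrow> 'a \<Rightarrow> real \<Rightarrow> 'a \<Rightarrow> real \<Rightarrow> nat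
       \<Rightarrow> ('a \<times> real \<times> bool \<times> nat) option" where
  "SCAR_PM_loop A h \<epsilon> y0 \<mu> y' M' N =
     do {
       (y, M, k) \<leftarrow> AR A h y' (\<mu> / 10) M';
       if norm (grad h y) \<le> \<epsilon>
       then Some (y, M, False, N + k + 1)
       else if norm (grad h y) > norm (grad h y') / 2
       then Some (y0, M, True, N + k + 1)
       else SCAR_PM_loop A h \<epsilon> y0 \<mu> y M (N + k + 1)
     }"

definition SCAR_PM ::
    "('a::euclidean_space) subroutine \<Rightarrow> ('a \<Rightarrow> real) \<Rightarrow> real \<Rightarrow> 'a \<Rightarrow> real \<Rightarrow> real
       \<Rightarrow> ('a \<times> real \<times> bool \<times> nat) option" where
  "SCAR_PM A h \<epsilon> y0 \<mu> M0 = SCAR_PM_loop A h \<epsilon> y0 \<mu> y0 M0 1"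

partial_function (option) NASCAR_loop ::
    "('a::euclidean_space) subroutine \<Rightarrow> ('a \<Rightarrow> real) \<Rightarrow> real \<Rightarrow> 'a \<Rightarrow> real \<Rightarrow> real \<Rightarrow> nat
       \<Rightarrow> ('a \<times> nat) option" where
  "NASCAR_loop A f \<epsilon> x' l M' N =
     do {
       (x, M, err, k) \<leftarrow> SCAR_PM A (\<lambda>z. f z + l * (norm (z - x'))\<^sup>2) (\<epsilon> / 4) x' l M';
       if norm (grad f x) \<le> \<epsilon>
       then Some (x, N + k + 1)
       else if err \<or> (norm (grad f x))\<^sup>2 > 10 * l * (f x' - f x)
       then NASCAR_loop A f \<epsilon> x' (4 * l) M (N + k + 1)
       else NASCAR_loop A f \<epsilon> x l M (N + k + 1)
     }"

definition NASCAR ::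
    "('a::euclidean_space) subroutine \<Rightarrow> ('a \<Rightarrow> real) \<Rightarrow> 'a \<Rightarrow> real \<Rightarrow> real \<Rightarrow> real \<Rightarrow> ('a \<times> nat) option" where
  "NASCAR A f x0 \<epsilon> l0 M0 = NASCAR_loop A f \<epsilon> x0 l0 M0 0"

definition C1 :: "real \<Rightarrow> real" where
  "C1 c = sqrt 2 * (3 + 16 * sqrt (2 * c))"

end

theory Submission
  imports Defs
begin

text \<open>
  NASCAR adds \<open>\<rho>\<close> times the squared distance to the current point \<open>x'\<close>, where \<open>\<rho>\<close> is the current value
  of the guess for the curvature \<open>l\<close>. Once \<open>\<rho> \<ge> l\<close>, the regularized function is \<open>\<rho>\<close>-strongly convex.
  Then accumulative regularization, started with the regularization \<open>\<rho> / 10\<close>, shrinks the gradient by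
  the factor 4: each round adds a stronger proximal term centered at a point that is already close to
  optimal, so the minimizers move by geometrically decreasing amounts that outpace the growth of the
  regularization (\<open>AR_loop_round\<close>, \<open>AR_correct\<close>). Hence the gradient of the regularized function is halved
  until it is at most \<open>\<epsilon> / 4\<close>, no error is raised, and unless the gradient of \<open>f\<close> is now at most \<open>\<epsilon>\<close>, the
  point has moved so far that \<open>f\<close> has decreased by a multiple of the squared gradient over \<open>\<rho>\<close>
  (\<open>sufficient_decrease\<close>). So \<open>\<rho>\<close> is increased only below \<open>l\<close> and stays below \<open>4 * l\<close>.

  While \<open>\<rho> < l\<close>, nothing is known about convexity, but the tests of the algorithm themselves bound the
  cost. Backtracking never overestimates the smoothness constant by more than the factor 2, the subroutine
  stops when its own estimate allows it, and the gradients are halved or an error is raised. One outer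
  iteration therefore costs at most \<open>\<kappa> * sqrt (L / \<rho> + 2) * (1 + log 2 (4 * G / \<epsilon>))\<close> evaluations in every
  case, where \<open>G\<close> is the norm of the gradient at \<open>x'\<close> and \<open>\<kappa>\<close> depends on the constant of the subroutine
  only (\<open>NASCAR_iteration\<close>).

  These costs are summed by a potential (\<open>NASCAR_loop_correct\<close>). Iterations that increase \<open>\<rho>\<close> at a fixed
  point form a geometric series, dominated by its first term. A point \<open>x\<close> that was accepted has a gradient
  of norm \<open>G > \<epsilon>\<close> with \<open>G\<^sup>2 \<le> 10 * \<rho> * (f x' - f x)\<close>; since \<open>1 + log 2 (4 * G / \<epsilon>) \<le> 3 * G\<^sup>2 / \<epsilon>\<^sup>2\<close>, the
  whole series of iterations from \<open>x\<close> is paid for by the decrease of \<open>f\<close> in the step that produced \<open>x\<close>.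
  Only the series of the starting point \<open>x0\<close> remains, which is the logarithmic term of the bound.
\<close>

section \<open>Gradients and smoothness of quadratically regularized functions\<close>

lemma GDERIV_unique:
  fixes f :: "'a::euclidean_space \<Rightarrow> real"
  assumes "GDERIV f x :> D" "GDERIV f x :> D'"
  shows "D = D'"
proof -
  have "(\<lambda>h. h \<bullet> D) = (\<lambda>h. h \<bullet> D')"
    using assms unfolding gderiv_def by (rule has_derivative_unique)
  then have "(D - D') \<bullet> D = (D - D') \<bullet> D'"
    by (rule fun_cong)
  then have "(D - D') \<bullet> (D - D') = 0"
    by (simp only: inner_diff_right diff_self)
  then show ?thesis
    by simp
qed

lemma grad_eqI:
  fixes f :: "'a::euclidean_space \<Rightarrow> real"
  assumes "GDERIV f x :> D"
  shows "grad f x = D"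
  unfolding grad_def using assms GDERIV_unique by blast

text \<open>
  The Riesz representation of the derivative: the adjoint of the derivative, applied to the
  number 1, is the gradient.
\<close>

lemma GDERIV_grad:
  fixes f :: "'a::euclidean_space \<Rightarrow> real"
  assumes "f differentiable (at x)"
  shows "GDERIV f x :> grad f x"
proof -
  obtain f' where f': "(f has_derivative f') (at x)"
    using assms unfolding differentiable_def by blast
  have "linear f'"
    using f' by (rule has_derivative_linear)
  then have "f' = (\<lambda>h. h \<bullet> adjoint f' 1)"
    by (simp add: adjoint_works)
  then have "GDERIV f x :> adjoint f' 1"
    using f' unfolding gderiv_def by simp
  then show ?thesis
    using grad_eqI[of f x "adjoint f' 1"] by simp
qed

lemma GDERIV_regularized:
  fixes f :: "'a::euclidean_space \<Rightarrow> real"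
  assumes "f differentiable (at x)"
  shows "GDERIV (regularized f \<sigma> c) x :> grad f x + \<sigma> *\<^sub>R (x - c)"
proof -
  have "GDERIV (\<lambda>x. (x - c) \<bullet> (x - c)) x :> 2 *\<^sub>R (x - c)"
    unfolding gderiv_def
    by (auto intro!: derivative_eq_intros simp: inner_commute)
  from GDERIV_add[OF GDERIV_grad[OF assms] GDERIV_mult[OF GDERIV_const[of "\<sigma> / 2"] this]]
  have "GDERIV (\<lambda>x. f x + \<sigma> / 2 * ((x - c) \<bullet> (x - c))) x :> grad f x + \<sigma> *\<^sub>R (x - c)"
    by simp
  moreover have "regularized f \<sigma> c = (\<lambda>x. f x + \<sigma> / 2 * ((x - c) \<bullet> (x - c)))"
    by (simp add: fun_eq_iff regularized_def power2_norm_eq_inner)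
  ultimately show ?thesis
    by simp
qed

lemma grad_regularized:
  fixes f :: "'a::euclidean_space \<Rightarrow> real"
  assumes "f differentiable (at x)"
  shows "grad (regularized f \<sigma> c) x = grad f x + \<sigma> *\<^sub>R (x - c)"
  using GDERIV_regularized[OF assms] by (rule grad_eqI)

lemma differentiable_regularized:
  fixes f :: "'a::euclidean_space \<Rightarrow> real"
  assumes "f differentiable (at x)"
  shows "regularized f \<sigma> c differentiable (at x)"
  using GDERIV_regularized[OF assms] unfolding gderiv_def by (rule differentiableI)

lemma smooth_differentiable: "smooth L f \<Longrightarrow> f differentiable (at x)"
  unfolding smooth_def by blast

lemma smoothD: "smooth L f \<Longrightarrow> norm (grad f x - grad f y) \<le> L * norm (x - y)"
  unfolding smooth_def by blast

lemma smooth_regularized: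
  fixes f :: "'a::euclidean_space \<Rightarrow> real"
  assumes f: "smooth L f" and "\<sigma> \<ge> 0"
  shows "smooth (L + \<sigma>) (regularized f \<sigma> c)"
  unfolding smooth_def
proof (intro conjI allI)
  fix x y
  note d = smooth_differentiable[OF f]
  show "regularized f \<sigma> c differentiable (at x)"
    using d by (rule differentiable_regularized)
  have "grad (regularized f \<sigma> c) x - grad (regularized f \<sigma> c) y
      = (grad f x - grad f y) + \<sigma> *\<^sub>R (x - y)"
    unfolding grad_regularized[OF d] by (simp add: algebra_simps)
  also have "norm \<dots> \<le> norm (grad f x - grad f y) + norm (\<sigma> *\<^sub>R (x - y))"
    by (rule norm_triangle_ineq)
  also have "\<dots> \<le> (L + \<sigma>) * norm (x - y)"
    using f \<open>\<sigma> \<ge> 0\<close> unfolding smooth_def by (simp add: distrib_right)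
  finally show "norm (grad (regularized f \<sigma> c) x - grad (regularized f \<sigma> c) y) \<le> (L + \<sigma>) * norm (x - y)" .
qed

lemma DERIV_along_line:
  fixes f :: "'a::euclidean_space \<Rightarrow> real"
  assumes "f differentiable (at (x + t *\<^sub>R d))"
  shows "((\<lambda>t. f (x + t *\<^sub>R d)) has_real_derivative grad f (x + t *\<^sub>R d) \<bullet> d) (at t)"
proof -
  have "(f has_derivative (\<lambda>h. h \<bullet> grad f (x + t *\<^sub>R d))) (at (x + t *\<^sub>R d))"
    using GDERIV_grad[OF assms] unfolding gderiv_def .
  moreover have "((\<lambda>t. x + t *\<^sub>R d) has_derivative (\<lambda>s. s *\<^sub>R d)) (at t)"
    by (auto intro!: derivative_eq_intros)
  ultimately have "((\<lambda>t. f (x + t *\<^sub>R d)) has_derivative (\<lambda>s. (s *\<^sub>R d) \<bullet> grad f (x + t *\<^sub>R d))) (at t)"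
    by (rule has_derivative_compose[rotated])
  then show ?thesis
    by (simp add: has_field_derivative_def inner_commute mult_commute_abs)
qed

text \<open>
  The difference of the two sides, restricted to the segment from \<open>x\<close> to \<open>y\<close>, has a nonpositive
  derivative by the Lipschitz condition on the gradient.
\<close>

lemma descent_inequality:
  fixes g :: "'a::euclidean_space \<Rightarrow> real"
  assumes g: "smooth L g"
  shows "g y - g x - grad g x \<bullet> (y - x) \<le> L / 2 * (norm (y - x))\<^sup>2"
proof -
  define d where "d = y - x"
  define \<phi> where "\<phi> t = g (x + t *\<^sub>R d) - t * (grad g x \<bullet> d) - L / 2 * t\<^sup>2 * (norm d)\<^sup>2" for t
  have "\<phi> 1 \<le> \<phi> 0"
  proof (rule DERIV_nonpos_imp_nonincreasing[of 0 1])
    fix t :: real assume t: "0 \<le> t" "t \<le> 1"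
    let ?D = "grad g (x + t *\<^sub>R d) \<bullet> d - grad g x \<bullet> d - L * t * (norm d)\<^sup>2"
    have "(\<phi> has_real_derivative ?D) (at t)"
      unfolding \<phi>_def
      by (auto intro!: derivative_eq_intros DERIV_along_line smooth_differentiable[OF g])
    moreover have "?D \<le> 0"
    proof -
      have "(grad g (x + t *\<^sub>R d) - grad g x) \<bullet> d \<le> norm (grad g (x + t *\<^sub>R d) - grad g x) * norm d"
        by (rule norm_cauchy_schwarz)
      also have "\<dots> \<le> (L * norm (x + t *\<^sub>R d - x)) * norm d"
        by (intro mult_right_mono smoothD[OF g]) simp
      finally show ?thesis
        using t by (simp add: inner_diff_left power2_eq_square mult.assoc)
    qed
    ultimately show "\<exists>D. (\<phi> has_real_derivative D) (at t) \<and> D \<le> 0"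
      by blast
  qed simp
  then show ?thesis
    unfolding \<phi>_def d_def by simp
qed

section \<open>Quadratic lower bounds on a function\<close>

text \<open>
  For positive \<open>m\<close> this is strong convexity, for \<open>m = 0\<close> convexity, and for negative \<open>m\<close> a lower
  curvature bound, all in first-order form. One real parameter covers the three cases, so that
  adding \<open>\<sigma> / 2\<close> times a squared distance just shifts it by \<open>\<sigma>\<close>.
\<close>

definition curvature_at_least :: "real \<Rightarrow> ('a::euclidean_space \<Rightarrow> real) \<Rightarrow> bool" where
 "curvature_at_least m g \<longleftrightarrow> (\<forall>x y. g x + grad g x \<bullet> (y - x) + m / 2 * (norm (y - x))\<^sup>2 \<le> g y)"
lemma convex_imp_curvature_at_least_0:
  fixes g :: "'a::euclidean_space \<Rightarrow> real"
  assumes diff: "\<And>x. g differentiable (at x)" and conv: "convex_on UNIV g"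
  shows "curvature_at_least 0 g"
  unfolding curvature_at_least_def
proof (intro allI)
  fix x y :: 'a
  let ?\<phi> = "\<lambda>t. g (x + t *\<^sub>R (y - x))"
  have "convex_on UNIV ?\<phi>"
  proof (rule convex_onI)
    fix t a b :: real
    assume t: "0 < t" "t < 1"
    have "x + ((1 - t) *\<^sub>R a + t *\<^sub>R b) *\<^sub>R (y - x)
       = (1 - t) *\<^sub>R (x + a *\<^sub>R (y - x)) + t *\<^sub>R (x + b *\<^sub>R (y - x))"
      by (simp add: algebra_simps)
    then show "?\<phi> ((1 - t) *\<^sub>R a + t *\<^sub>R b) \<le> (1 - t) * ?\<phi> a + t * ?\<phi> b"
      using convex_onD[OF conv, of t "x + a *\<^sub>R (y - x)" "x + b *\<^sub>R (y - x)"] t by simp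
  qed simp
  then have "?\<phi> 1 - ?\<phi> 0 \<ge> grad g x \<bullet> (y - x) * (1 - 0)"
    using DERIV_along_line[of g x 0 "y - x", OF diff]
    by (intro convex_on_imp_above_tangent[of UNIV]) (auto simp: connected_UNIV)
  then show "g x + grad g x \<bullet> (y - x) + 0 / 2 * (norm (y - x))\<^sup>2 \<le> g y"
    by simp
qed

lemma curvature_at_leastD:
  "curvature_at_least m g \<Longrightarrow> g x + grad g x \<bullet> (y - x) + m / 2 * (norm (y - x))\<^sup>2 \<le> g y"
  unfolding curvature_at_least_def by blast

lemma curvature_at_least_mono:
  fixes g :: "'a::euclidean_space \<Rightarrow> real"
  assumes "curvature_at_least m g" and "m' \<le> m"
  shows "curvature_at_least m' g"
  unfolding curvature_at_least_def
proof (intro allI)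
  fix x y :: 'a
  have "m' / 2 * (norm (y - x))\<^sup>2 \<le> m / 2 * (norm (y - x))\<^sup>2"
    using assms(2) by (intro mult_right_mono) auto
  then show "g x + grad g x \<bullet> (y - x) + m' / 2 * (norm (y - x))\<^sup>2 \<le> g y"
    using curvature_at_leastD[OF assms(1), of x y] by linarith
qed

lemma curvature_at_least_0_imp_convex:
  fixes g :: "'a::euclidean_space \<Rightarrow> real"
  assumes "curvature_at_least 0 g"
  shows "convex_on UNIV g"
proof (rule convex_onI)
  fix t :: real and x y :: 'a
  assume t: "0 < t" "t < 1"
  define w where "w = (1 - t) *\<^sub>R x + t *\<^sub>R y"
  have tangent: "g w + grad g w \<bullet> (u - w) \<le> g u" for u
    using curvature_at_leastD[OF assms, of w u] by simp
  have "(1 - t) * (g w + grad g w \<bullet> (x - w)) + t * (g w + grad g w \<bullet> (y - w))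
      \<le> (1 - t) * g x + t * g y"
    using t tangent by (intro add_mono mult_left_mono) auto
  moreover have "(1 - t) * (g w + grad g w \<bullet> (x - w)) + t * (g w + grad g w \<bullet> (y - w))
      = g w + grad g w \<bullet> ((1 - t) *\<^sub>R (x - w) + t *\<^sub>R (y - w))"
    by (simp add: inner_add_right algebra_simps)
  moreover have "(1 - t) *\<^sub>R (x - w) + t *\<^sub>R (y - w) = 0"
    unfolding w_def by (simp add: algebra_simps)
  ultimately have "g w \<le> (1 - t) * g x + t * g y"
    by simp
  then show "g ((1 - t) *\<^sub>R x + t *\<^sub>R y) \<le> (1 - t) * g x + t * g y"
    unfolding w_def .
qed simp

text \<open>
  The quadratic lower bound at the origin exceeds the value at the origin outside the ball of radius
  \<open>r\<close>, so a minimizer over this compact ball is a global one.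
\<close>

lemma arg_min_exists:
  fixes g :: "'a::euclidean_space \<Rightarrow> real"
  assumes diff: "\<And>x. g differentiable (at x)" and m: "m > 0" and curv: "curvature_at_least m g"
  shows "\<exists>z. is_arg_min g (\<lambda>_. True) z"
proof -
  define r where "r = 2 * norm (grad g 0) / m"
  have "r \<ge> 0"
    using m by (simp add: r_def)
  have "continuous_on (cball 0 r) g"
    using diff by (intro continuous_at_imp_continuous_on ballI differentiable_imp_continuous_within)
  then obtain z where z: "z \<in> cball 0 r" "\<And>y. y \<in> cball 0 r \<Longrightarrow> g z \<le> g y"
    using continuous_attains_inf[of "cball 0 r" g] \<open>r \<ge> 0\<close> by auto
  have "g z \<le> g y" for y
  proof (cases "norm y \<le> r")
    case True
    then show ?thesis using z by simp
  next
    case False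
    have "g 0 + grad g 0 \<bullet> y + m / 2 * (norm y)\<^sup>2 \<le> g y"
      using curvature_at_leastD[OF curv, of 0 y] by simp
    moreover have "- (grad g 0 \<bullet> y) \<le> norm (grad g 0) * norm y"
      using Cauchy_Schwarz_ineq2[of "grad g 0" y] by linarith
    moreover have "norm (grad g 0) * norm y \<le> m / 2 * (norm y)\<^sup>2"
    proof -
      have "norm (grad g 0) \<le> m / 2 * norm y"
        using False m by (simp add: r_def field_simps)
      then have "norm (grad g 0) * norm y \<le> (m / 2 * norm y) * norm y"
        by (rule mult_right_mono) simp
      then show ?thesis
        by (simp add: power2_eq_square mult.assoc)
    qed
    moreover have "g z \<le> g 0"
      using z(2)[of 0] \<open>r \<ge> 0\<close> by simp
    ultimately show ?thesis by linarith
  qed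
  then show ?thesis
    by (auto simp: is_arg_min_def not_less)
qed

lemma grad_arg_min:
  fixes g :: "'a::euclidean_space \<Rightarrow> real"
  assumes diff: "g differentiable (at z)" and z: "is_arg_min g (\<lambda>_. True) z"
  shows "grad g z = 0"
proof -
  have "((\<lambda>t. g (z + t *\<^sub>R grad g z)) has_real_derivative grad g z \<bullet> grad g z) (at 0)"
    using DERIV_along_line[of g z 0 "grad g z"] diff by simp
  then have "grad g z \<bullet> grad g z = 0"
    by (rule DERIV_local_min[where d = 1]) (use z in \<open>auto simp: is_arg_min_def not_less\<close>)
  then show ?thesis by simp
qed

lemma quadratic_growth:
  fixes g :: "'a::euclidean_space \<Rightarrow> real"
  assumes diff: "g differentiable (at z)" and z: "is_arg_min g (\<lambda>_. True) z"
    and curv: "curvature_at_least m g"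
  shows "m / 2 * (norm (x - z))\<^sup>2 \<le> g x - g z"
proof -
  have "g z + grad g z \<bullet> (x - z) + m / 2 * (norm (x - z))\<^sup>2 \<le> g x"
    using curv by (rule curvature_at_leastD)
  then show ?thesis using grad_arg_min[OF diff z] by simp
qed

text \<open>
  Adding the quadratic growth at the minimizer to the quadratic lower bound at \<open>x\<close> leaves
  \<open>m\<close> times the squared distance below the inner product of the gradient with the displacement.
\<close>

lemma dist_arg_min_le_grad:
  fixes g :: "'a::euclidean_space \<Rightarrow> real"
  assumes diff: "g differentiable (at z)" and z: "is_arg_min g (\<lambda>_. True) z"
    and curv: "curvature_at_least m g"
  shows "m * norm (x - z) \<le> norm (grad g x)"
proof (cases "x = z")
  case False
  have "g x + grad g x \<bullet> (z - x) + m / 2 * (norm (z - x))\<^sup>2 \<le> g z"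
    using curv by (rule curvature_at_leastD)
  moreover have "- (grad g x \<bullet> (z - x)) \<le> norm (grad g x) * norm (z - x)"
    using Cauchy_Schwarz_ineq2[of "grad g x" "z - x"] by linarith
  ultimately have "(m * norm (x - z)) * norm (x - z) \<le> norm (grad g x) * norm (x - z)"
    using quadratic_growth[OF diff z curv, of x]
    by (simp add: norm_minus_commute power2_eq_square)
  then show ?thesis using False by simp
qed simp

lemma curvature_at_least_regularized:
  fixes g :: "'a::euclidean_space \<Rightarrow> real"
  assumes "\<And>x. g differentiable (at x)"
  shows "curvature_at_least (m + \<sigma>) (regularized g \<sigma> c) \<longleftrightarrow> curvature_at_least m g"
proof -
  have "regularized g \<sigma> c x + grad (regularized g \<sigma> c) x \<bullet> (y - x) + (m + \<sigma>) / 2 * (norm (y - x))\<^sup>2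
           \<le> regularized g \<sigma> c y
     \<longleftrightarrow> g x + grad g x \<bullet> (y - x) + m / 2 * (norm (y - x))\<^sup>2 \<le> g y" for x y
  proof -
    have "(norm (y - c))\<^sup>2 = (norm (x - c))\<^sup>2 + 2 * ((x - c) \<bullet> (y - x)) + (norm (y - x))\<^sup>2"
      using dot_norm[of "x - c" "y - x"] by simp
    then show ?thesis
      unfolding grad_regularized[OF assms] regularized_def
      by (simp add: inner_add_left distrib_left distrib_right add_divide_distrib add.assoc)
  qed
  then show ?thesis
    unfolding curvature_at_least_def by simp
qed

lemma lower_curvature_imp_curvature_at_least:
  fixes f :: "'a::euclidean_space \<Rightarrow> real"
  assumes "\<And>x. f differentiable (at x)" and "lower_curvature l f"
  shows "curvature_at_least (- l) f"
proof -
  have "(\<lambda>x. f x + l / 2 * (norm x)\<^sup>2) = regularized f l 0"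
    by (simp add: fun_eq_iff regularized_def)
  then have "curvature_at_least 0 (regularized f l 0)"
    using assms unfolding lower_curvature_def
    by (intro convex_imp_curvature_at_least_0 differentiable_regularized) auto
  then show ?thesis
    using curvature_at_least_regularized[OF assms(1), of "- l" l 0] by simp
qed

section \<open>Backtracking and the subroutine\<close>

lemma gradient_step_decrease:
  fixes g :: "'a::euclidean_space \<Rightarrow> real"
  assumes K: "0 < K" and y: "y = x - (1 / (2 * K)) *\<^sub>R grad g x"
    and test: "g y - g x - grad g x \<bullet> (y - x) \<le> K / 2 * (norm (y - x))\<^sup>2"
  shows "3 / 8 * (norm (grad g x))\<^sup>2 \<le> K * (g x - g y)"
proof -
  let ?G = "(norm (grad g x))\<^sup>2"
  have "grad g x \<bullet> (y - x) = - (?G / (2 * K))"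
    unfolding y by (simp add: power2_norm_eq_inner)
  moreover have "(norm (y - x))\<^sup>2 = ?G / (2 * K)\<^sup>2"
    unfolding y using K by (simp add: power_divide)
  then have "K / 2 * (norm (y - x))\<^sup>2 = ?G / (8 * K)"
    using K by (simp add: power2_eq_square)
  ultimately have "?G / (2 * K) - ?G / (8 * K) \<le> g x - g y"
    using test by simp
  then have "K * (?G / (2 * K) - ?G / (8 * K)) \<le> K * (g x - g y)"
    using K by (intro mult_left_mono) auto
  moreover have "K * (?G / (2 * K) - ?G / (8 * K)) = 3 / 8 * ?G"
    using K by (simp add: field_simps)
  ultimately show ?thesis by simp
qed

text \<open>
  An estimate \<open>M \<ge> Lg\<close> passes the test by the descent inequality, so a rejected \<open>M\<close> is below \<open>Lg\<close>
  and doubling it cannot exceed \<open>2 * Lg\<close>. The passed test certifies a decrease, and hence a bound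
  of the gradient by the optimality gap. The smoothness constant is written \<open>Lg + \<sigma>\<close> because the
  method estimates \<open>M\<close> for the function before its regularization by \<open>\<sigma>\<close>.
\<close>

lemma backtracking_correct:
  fixes g :: "'a::euclidean_space \<Rightarrow> real"
  assumes g: "smooth (Lg + \<sigma>) g" and \<sigma>: "0 \<le> \<sigma>" and M: "0 < M"
  shows "\<exists>M'. backtracking g \<sigma> x M = Some M' \<and> 0 < M' \<and> M' \<le> max M (2 * Lg) \<and>
           (\<exists>y. 3 / 8 * (norm (grad g x))\<^sup>2 \<le> (M' + \<sigma>) * (g x - g y))"
proof -
  obtain n where "Lg / M < 2 ^ n"
    using real_arch_pow[of 2 "Lg / M"] by auto
  then have "Lg \<le> 2 ^ n * M"
    using M by (simp add: field_simps)
  with M show ?thesis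
  proof (induction n arbitrary: M)
    case (0 M)
    define y where "y = x - (1 / (2 * (M + \<sigma>))) *\<^sub>R grad g x"
    have "g y - g x - grad g x \<bullet> (y - x) \<le> (Lg + \<sigma>) / 2 * (norm (y - x))\<^sup>2"
      by (rule descent_inequality[OF g])
    also have "\<dots> \<le> (M + \<sigma>) / 2 * (norm (y - x))\<^sup>2"
      using 0 by (intro mult_right_mono) auto
    finally have test: "g y - g x - grad g x \<bullet> (y - x) \<le> (M + \<sigma>) / 2 * (norm (y - x))\<^sup>2" .
    then have "backtracking g \<sigma> x M = Some M"
      by (subst backtracking.simps) (simp add: Let_def y_def)
    moreover have "3 / 8 * (norm (grad g x))\<^sup>2 \<le> (M + \<sigma>) * (g x - g y)"
      using 0 \<sigma> by (intro gradient_step_decrease y_def test) auto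
    ultimately show ?case
      using 0 by auto
  next
    case (Suc n M)
    define y where "y = x - (1 / (2 * (M + \<sigma>))) *\<^sub>R grad g x"
    show ?case
    proof (cases "g y - g x - grad g x \<bullet> (y - x) \<le> (M + \<sigma>) / 2 * (norm (y - x))\<^sup>2")
      case test: True
      then have "backtracking g \<sigma> x M = Some M"
        by (subst backtracking.simps) (simp add: Let_def y_def)
      moreover have "3 / 8 * (norm (grad g x))\<^sup>2 \<le> (M + \<sigma>) * (g x - g y)"
        using Suc.prems \<sigma> by (intro gradient_step_decrease y_def test) auto
      ultimately show ?thesis
        using Suc.prems by auto
    next
      case False
      then have step: "backtracking g \<sigma> x M = backtracking g \<sigma> x (2 * M)"
        by (subst backtracking.simps) (simp add: Let_def y_def)
      have "M < Lg"
      proof (rule ccontr)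
        assume "\<not> M < Lg"
        then have "(Lg + \<sigma>) / 2 * (norm (y - x))\<^sup>2 \<le> (M + \<sigma>) / 2 * (norm (y - x))\<^sup>2"
          by (intro mult_right_mono) auto
        with descent_inequality[OF g, of y x] False show False
          by linarith
      qed
      moreover obtain M' where M': "backtracking g \<sigma> x (2 * M) = Some M'" "0 < M'"
          "M' \<le> max (2 * M) (2 * Lg)"
          "\<exists>y. 3 / 8 * (norm (grad g x))\<^sup>2 \<le> (M' + \<sigma>) * (g x - g y)"
        using Suc.IH[of "2 * M"] Suc.prems by (auto simp: mult_ac)
      ultimately show ?thesis
        using step by (intro exI[of _ M']) auto
    qed
  qed
qed

text \<open>
  Since every estimate is at most \<open>U\<close>, the test passes at the latest at the first \<open>k\<close> that reaches
  \<open>8 * sqrt (2 * U / \<sigma>)\<close>; rounding up to an integer costs the additional 1.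
\<close>

lemma run_subroutine_correct:
  fixes A :: "('a::euclidean_space) subroutine"
  assumes "0 < \<sigma>" and U: "\<And>k. 1 \<le> k \<Longrightarrow> snd (A h \<sigma> xbar x0 k) \<le> U" and "0 \<le> U"
  shows "\<exists>x k Lk. run_subroutine A h \<sigma> xbar x0 = Some (x, k) \<and> A h \<sigma> xbar x0 k = (x, Lk) \<and>
           1 \<le> k \<and> 8 * sqrt (2 * Lk / \<sigma>) \<le> real k \<and> real k \<le> 1 + 8 * sqrt (2 * U / \<sigma>)"
proof -
  define B where "B = 8 * sqrt (2 * U / \<sigma>)"
  have B: "8 * sqrt (2 * Lk / \<sigma>) \<le> B" if "A h \<sigma> xbar x0 k = (x, Lk)" "1 \<le> k" for x k Lk
    unfolding B_def using U[OF that(2)] that \<open>0 < \<sigma>\<close> by (simp add: divide_right_mono)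
  have from_k: "\<exists>x k' Lk. run_subroutine_from k A h \<sigma> xbar x0 = Some (x, k') \<and>
        A h \<sigma> xbar x0 k' = (x, Lk) \<and> 1 \<le> k' \<and> 8 * sqrt (2 * Lk / \<sigma>) \<le> real k' \<and> real k' \<le> 1 + B"
    if "1 \<le> k" "real k \<le> 1 + B" "B \<le> real (k + n)" for k n
    using that
  proof (induction n arbitrary: k)
    case (0 k)
    obtain x Lk where xL: "A h \<sigma> xbar x0 k = (x, Lk)"
      by fastforce
    then have test: "8 * sqrt (2 * Lk / \<sigma>) \<le> real k"
      using B[OF xL] 0 by simp
    then have "run_subroutine_from k A h \<sigma> xbar x0 = Some (x, k)"
      using xL by (subst run_subroutine_from.simps) simp
    then show ?case
      using test 0 xL by blast
  next
    case (Suc n k)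
    obtain x Lk where xL: "A h \<sigma> xbar x0 k = (x, Lk)"
      by fastforce
    show ?case
    proof (cases "8 * sqrt (2 * Lk / \<sigma>) \<le> real k")
      case test: True
      then have "run_subroutine_from k A h \<sigma> xbar x0 = Some (x, k)"
        using xL by (subst run_subroutine_from.simps) simp
      then show ?thesis
        using test Suc.prems xL by blast
    next
      case False
      then have "run_subroutine_from k A h \<sigma> xbar x0 = run_subroutine_from (k + 1) A h \<sigma> xbar x0"
        using xL by (subst run_subroutine_from.simps) simp
      moreover have "real (k + 1) \<le> 1 + B"
        using False B[OF xL] Suc.prems by simp
      ultimately show ?thesis
        using Suc.IH[of "k + 1"] Suc.prems by simp
    qed
  qed
  obtain n where "B \<le> real n"
    using real_arch_simple by blast
  moreover have "0 \<le> B"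
    unfolding B_def using \<open>0 \<le> U\<close> \<open>0 < \<sigma>\<close> by simp
  ultimately show ?thesis
    using from_k[of 1 n] unfolding run_subroutine_def B_def by simp
qed

text \<open>
  The zero function is \<open>Lh\<close>-smooth for every nonnegative \<open>Lh\<close>. A negative \<open>c\<close> would thus put one fixed
  estimate below arbitrarily negative numbers.
\<close>

lemma subroutine_constant_nonneg:
  fixes A :: "('a::euclidean_space) subroutine"
  assumes "subroutine_assumption c A"
  shows "0 \<le> c"
proof (rule ccontr)
  assume "\<not> 0 \<le> c"
  obtain xk Lk where A1: "A (\<lambda>_. 0) 1 0 0 1 = (xk, Lk)"
    by fastforce
  have grad0: "grad (\<lambda>_. 0) x = 0" for x :: 'a
    by (rule grad_eqI) (rule GDERIV_const)
  have "Lk \<le> c * Lh" if "0 \<le> Lh" for Lh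
  proof -
    have "smooth Lh (\<lambda>_ :: 'a. 0)"
      using that by (simp add: smooth_def grad0)
    with A1 assms show ?thesis
      unfolding subroutine_assumption_def by (metis le_refl zero_less_one)
  qed
  moreover have "0 \<le> (\<bar>Lk\<bar> + 1) / - c"
    using \<open>\<not> 0 \<le> c\<close> by (intro divide_nonneg_nonneg) auto
  ultimately have "Lk \<le> c * ((\<bar>Lk\<bar> + 1) / - c)"
    by blast
  then show False
    using \<open>\<not> 0 \<le> c\<close> by simp
qed

section \<open>Accumulative regularization\<close>

text \<open>
  The averaged prox center is chosen such that, up to a constant, passing to the next round adds
  only a proximal term centered at the current point.
\<close>

lemma regularized_recenter:
  fixes h :: "'a::euclidean_space \<Rightarrow> real"
  assumes "\<sigma> \<noteq> 0" and \<gamma>: "\<gamma> = 1 - \<sigma>' / \<sigma>" and xbar: "xbar = (1 - \<gamma>) *\<^sub>R xbar' + \<gamma> *\<^sub>R x'"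
  shows "regularized h \<sigma> xbar x =
           regularized h \<sigma>' xbar' x + (\<sigma> - \<sigma>') / 2 * (norm (x - x'))\<^sup>2
           - \<sigma> / 2 * (1 - \<gamma>) * \<gamma> * (norm (x' - xbar'))\<^sup>2"
proof -
  define a b where "a = x - xbar'" and "b = x - x'"
  have "x - xbar = (1 - \<gamma>) *\<^sub>R a + \<gamma> *\<^sub>R b"
    unfolding xbar a_def b_def by (simp add: algebra_simps)
  moreover have "x' - xbar' = a - b"
    unfolding a_def b_def by simp
  moreover have "(norm ((1 - \<gamma>) *\<^sub>R a + \<gamma> *\<^sub>R b))\<^sup>2 =
      (1 - \<gamma>) * (norm a)\<^sup>2 + \<gamma> * (norm b)\<^sup>2 - (1 - \<gamma>) * \<gamma> * (norm (a - b))\<^sup>2"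
    unfolding power2_norm_eq_inner
    by (simp add: inner_add inner_diff inner_commute algebra_simps)
  moreover have "\<sigma> * (1 - \<gamma>) = \<sigma>'" "\<sigma> * \<gamma> = \<sigma> - \<sigma>'"
    using \<gamma> \<open>\<sigma> \<noteq> 0\<close> by (simp_all add: field_simps)
  ultimately have "\<sigma> * (norm (x - xbar))\<^sup>2 =
      \<sigma>' * (norm a)\<^sup>2 + (\<sigma> - \<sigma>') * (norm b)\<^sup>2 - \<sigma> * (1 - \<gamma>) * \<gamma> * (norm (x' - xbar'))\<^sup>2"
    by (simp add: right_diff_distrib distrib_left flip: mult.assoc)
  then show ?thesis
    unfolding regularized_def a_def b_def by (simp add: field_simps)
qed

text \<open>
  By the recentering identity the new minimizer \<open>z\<close> minimizes the old objective plus a multiple of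
  the squared distance to \<open>x'\<close>. Since \<open>z'\<close> is already optimal for the old objective, \<open>z\<close> can only
  compete by being closer to \<open>x'\<close>. This is what makes the rounds chain together.
\<close>

lemma arg_min_regularized_closer:
  fixes h :: "'a::euclidean_space \<Rightarrow> real"
  assumes "0 \<le> \<sigma>'" "\<sigma>' < \<sigma>"
    and \<gamma>: "\<gamma> = 1 - \<sigma>' / \<sigma>" and xbar: "xbar = (1 - \<gamma>) *\<^sub>R xbar' + \<gamma> *\<^sub>R x'"
    and z': "is_arg_min (regularized h \<sigma>' xbar') (\<lambda>_. True) z'"
    and z: "is_arg_min (regularized h \<sigma> xbar) (\<lambda>_. True) z"
  shows "norm (x' - z) \<le> norm (x' - z')"
proof -
  have "regularized h \<sigma> xbar z \<le> regularized h \<sigma> xbar z'"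
    "regularized h \<sigma>' xbar' z' \<le> regularized h \<sigma>' xbar' z"
    using z z' by (auto simp: is_arg_min_def not_less)
  then have "(\<sigma> - \<sigma>') / 2 * (norm (z - x'))\<^sup>2 \<le> (\<sigma> - \<sigma>') / 2 * (norm (z' - x'))\<^sup>2"
    using regularized_recenter[OF _ \<gamma> xbar, of h z] regularized_recenter[OF _ \<gamma> xbar, of h z'] assms(1,2)
    by linarith
  then have "(norm (z - x'))\<^sup>2 \<le> (norm (z' - x'))\<^sup>2"
    using assms(2) by simp
  then have "norm (z - x') \<le> norm (z' - x')"
    by (rule power2_le_imp_le) simp
  then show ?thesis
    by (simp add: norm_minus_commute)
qed

text \<open>
  The stopping test makes the gap at most \<open>\<sigma> / 128\<close> times the squared distance to the minimizer, and
  \<open>\<sigma>\<close>-strong convexity turns this into a contraction of the distance by the factor 8.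
\<close>

lemma AR_round:
  fixes h :: "'a::euclidean_space \<Rightarrow> real"
  assumes sub: "subroutine_assumption c A" and h: "smooth Lh h" and conv: "curvature_at_least 0 h"
    and \<sigma>: "0 \<le> \<sigma>'" "\<sigma>' < \<sigma>"
    and \<gamma>: "\<gamma> = 1 - \<sigma>' / \<sigma>" and xbar: "xbar = (1 - \<gamma>) *\<^sub>R xbar' + \<gamma> *\<^sub>R x'"
    and z': "is_arg_min (regularized h \<sigma>' xbar') (\<lambda>_. True) z'"
    and run: "A h \<sigma> xbar x' k = (x, Lk)" "1 \<le> k" "8 * sqrt (2 * Lk / \<sigma>) \<le> real k"
  obtains z where "is_arg_min (regularized h \<sigma> xbar) (\<lambda>_. True) z"
    "norm (x - z) \<le> norm (x' - z') / 8"
    "norm (x - x') \<le> 9 / 8 * norm (x' - z')"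
    "regularized h \<sigma> xbar x - regularized h \<sigma> xbar z \<le> \<sigma> / 128 * (norm (x' - z'))\<^sup>2"
proof -
  have "0 < \<sigma>" using \<sigma> by simp
  note dh = smooth_differentiable[OF h]
  have diff: "\<And>u. regularized h \<sigma> xbar differentiable (at u)"
    by (intro differentiable_regularized dh)
  have curv: "curvature_at_least \<sigma> (regularized h \<sigma> xbar)"
    using conv curvature_at_least_regularized[of h 0 \<sigma> xbar] dh by simp
  obtain z where z: "is_arg_min (regularized h \<sigma> xbar) (\<lambda>_. True) z"
    using arg_min_exists[OF diff \<open>0 < \<sigma>\<close> curv] by blast
  have closer: "norm (x' - z) \<le> norm (x' - z')"
    using arg_min_regularized_closer[OF \<sigma> \<gamma> xbar z' z] .
  have "Lk / (real k)\<^sup>2 \<le> \<sigma> / 128"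
  proof (cases "Lk \<le> 0")
    case True
    then have "Lk / (real k)\<^sup>2 \<le> 0"
      by (simp add: divide_nonpos_nonneg)
    then show ?thesis using \<open>0 < \<sigma>\<close> by (meson divide_pos_pos less_imp_le order_trans zero_less_numeral)
  next
    case False
    then have "(8 * sqrt (2 * Lk / \<sigma>))\<^sup>2 \<le> (real k)\<^sup>2"
      using run(3) \<open>0 < \<sigma>\<close> by (intro power_mono) auto
    then have "64 * (2 * Lk / \<sigma>) \<le> (real k)\<^sup>2"
      using False \<open>0 < \<sigma>\<close> by (simp add: power_mult_distrib)
    then show ?thesis
      using \<open>0 < \<sigma>\<close> run(2) by (simp add: field_simps)
  qed
  then have "Lk / (real k)\<^sup>2 * (norm (x' - z))\<^sup>2 \<le> \<sigma> / 128 * (norm (x' - z'))\<^sup>2"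
    using closer \<open>0 < \<sigma>\<close> by (intro mult_mono power_mono) auto
  moreover have "regularized h \<sigma> xbar x - regularized h \<sigma> xbar z \<le> Lk / (real k)\<^sup>2 * (norm (x' - z))\<^sup>2"
    using sub h \<open>0 < \<sigma>\<close> run(1,2) curvature_at_least_0_imp_convex[OF conv] z
    unfolding subroutine_assumption_def by blast
  ultimately have gap: "regularized h \<sigma> xbar x - regularized h \<sigma> xbar z \<le> \<sigma> / 128 * (norm (x' - z'))\<^sup>2"
    by linarith
  have "\<sigma> / 2 * (norm (x - z))\<^sup>2 \<le> \<sigma> / 128 * (norm (x' - z'))\<^sup>2"
    using quadratic_growth[OF diff z curv, of x] gap by linarith
  then have "(norm (x - z))\<^sup>2 \<le> (norm (x' - z') / 8)\<^sup>2"
    using \<open>0 < \<sigma>\<close> by (simp add: power_divide field_simps)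
  then have xz: "norm (x - z) \<le> norm (x' - z') / 8"
    by (rule power2_le_imp_le) simp
  have "norm (x - x') \<le> norm (x - z) + norm (x' - z)"
    using norm_triangle_ineq4[of "x - z" "x' - z"] by simp
  then have "norm (x - x') \<le> 9 / 8 * norm (x' - z')"
    using xz closer by linarith
  with z xz gap show thesis
    by (intro that)
qed

text \<open>
  The potential is the norm of the accumulated proximal gradient \<open>\<sigma>' *\<^sub>R (x' - xbar')\<close> plus
  \<open>5 / 2 * \<sigma>\<close> times the distance \<open>a\<close> from \<open>x'\<close> to the previous minimizer. A round adds at most
  \<open>9 / 8 * \<sigma> * a\<close> to the first summand, while in the second one \<open>\<sigma>\<close> grows by 4 and the distance shrinks
  by 8, which leaves \<open>5 / 4 * \<sigma> * a\<close>: as \<open>9 / 8 + 5 / 4 \<le> 5 / 2\<close>, the potential does not increase.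
  In the last round the gradient of the regularized function contributes at most \<open>\<sigma> * a / 4\<close>, because
  \<open>M \<le> \<sigma>\<close>, and the potential bounds the gradient of \<open>h\<close> itself. Without convexity only the bounds on
  the estimate and on the number of evaluations hold.
\<close>

lemma AR_loop_round:
  fixes h :: "'a::euclidean_space \<Rightarrow> real"
  assumes sub: "subroutine_assumption c A" and h: "smooth Lh h" and Lh: "0 < Lh"
    and \<sigma>: "0 \<le> \<sigma>'" "\<sigma>' < \<sigma>" and M': "0 < M'" "M' \<le> 4 * Lh"
  obtains x k M xbar where
    "AR_loop A h \<sigma>' \<sigma> xbar' x' M' N =
       (if M \<le> \<sigma> then Some (x, M, N + k + 1) else AR_loop A h \<sigma> (4 * \<sigma>) xbar x M (N + k + 1))"
    "0 < M" "M \<le> 2 * Lh" "real k \<le> 1 + 8 * sqrt (2 * (c * Lh) / \<sigma>)"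
    "\<And>z'. curvature_at_least 0 h \<Longrightarrow> is_arg_min (regularized h \<sigma>' xbar') (\<lambda>_. True) z' \<Longrightarrow>
       (M \<le> \<sigma> \<longrightarrow> norm (grad h x) \<le> norm (\<sigma>' *\<^sub>R (x' - xbar')) + 5 / 2 * \<sigma> * norm (x' - z')) \<and>
       (\<exists>z. is_arg_min (regularized h \<sigma> xbar) (\<lambda>_. True) z \<and>
          norm (\<sigma> *\<^sub>R (x - xbar)) + 5 / 2 * (4 * \<sigma>) * norm (x - z)
            \<le> norm (\<sigma>' *\<^sub>R (x' - xbar')) + 5 / 2 * \<sigma> * norm (x' - z'))"
proof -
  have "0 < \<sigma>" using \<sigma> by simp
  define \<gamma> where "\<gamma> = 1 - \<sigma>' / \<sigma>"
  define xbar where "xbar = (1 - \<gamma>) *\<^sub>R xbar' + \<gamma> *\<^sub>R x'"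
  have "0 \<le> c * Lh"
    using subroutine_constant_nonneg[OF sub] Lh by simp
  moreover have "snd (A h \<sigma> xbar x' k) \<le> c * Lh" if "1 \<le> k" for k
    using sub h \<open>0 < \<sigma>\<close> that surjective_pairing[of "A h \<sigma> xbar x' k"]
    unfolding subroutine_assumption_def by blast
  ultimately obtain x k Lk where run: "run_subroutine A h \<sigma> xbar x' = Some (x, k)"
      "A h \<sigma> xbar x' k = (x, Lk)" "1 \<le> k" "8 * sqrt (2 * Lk / \<sigma>) \<le> real k"
    and k: "real k \<le> 1 + 8 * sqrt (2 * (c * Lh) / \<sigma>)"
    using run_subroutine_correct[OF \<open>0 < \<sigma>\<close>, of A h xbar x' "c * Lh"] by blast
  let ?hs = "regularized h \<sigma> xbar"
  obtain M y where M: "backtracking ?hs \<sigma> x (M' / 2) = Some M" "0 < M" "M \<le> max (M' / 2) (2 * Lh)"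
    and y: "3 / 8 * (norm (grad ?hs x))\<^sup>2 \<le> (M + \<sigma>) * (?hs x - ?hs y)"
    using backtracking_correct[OF smooth_regularized[OF h, of \<sigma> xbar], of "M' / 2" x] \<open>0 < \<sigma>\<close> M' by auto
  have loop: "AR_loop A h \<sigma>' \<sigma> xbar' x' M' N =
       (if M \<le> \<sigma> then Some (x, M, N + k + 1) else AR_loop A h \<sigma> (4 * \<sigma>) xbar x M (N + k + 1))"
    by (subst AR_loop.simps) (simp add: Let_def run(1) M(1) flip: \<gamma>_def xbar_def)
  have M_le: "M \<le> 2 * Lh"
    using M(3) M' by simp
  have bounds: "(M \<le> \<sigma> \<longrightarrow> norm (grad h x) \<le> norm (\<sigma>' *\<^sub>R (x' - xbar')) + 5 / 2 * \<sigma> * norm (x' - z')) \<and>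
       (\<exists>z. is_arg_min ?hs (\<lambda>_. True) z \<and>
          norm (\<sigma> *\<^sub>R (x - xbar)) + 5 / 2 * (4 * \<sigma>) * norm (x - z)
            \<le> norm (\<sigma>' *\<^sub>R (x' - xbar')) + 5 / 2 * \<sigma> * norm (x' - z'))"
    if conv: "curvature_at_least 0 h" and z': "is_arg_min (regularized h \<sigma>' xbar') (\<lambda>_. True) z'" for z'
  proof -
    define a where "a = norm (x' - z')"
    obtain z where z: "is_arg_min ?hs (\<lambda>_. True) z" "norm (x - z) \<le> a / 8"
      "norm (x - x') \<le> 9 / 8 * a" "?hs x - ?hs z \<le> \<sigma> / 128 * a\<^sup>2"
      using AR_round[OF sub h conv \<sigma> \<gamma>_def xbar_def z' run(2-)] unfolding a_def by blast
    have "\<sigma> *\<^sub>R xbar = \<sigma>' *\<^sub>R xbar' + (\<sigma> - \<sigma>') *\<^sub>R x'"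
      unfolding xbar_def \<gamma>_def using \<open>0 < \<sigma>\<close> by (simp add: scaleR_add_right right_diff_distrib)
    then have "\<sigma> *\<^sub>R (x - xbar) = \<sigma>' *\<^sub>R (x' - xbar') + \<sigma> *\<^sub>R (x - x')"
      by (simp add: scaleR_diff_right scaleR_diff_left)
    then have "norm (\<sigma> *\<^sub>R (x - xbar)) \<le> norm (\<sigma>' *\<^sub>R (x' - xbar')) + \<sigma> * norm (x - x')"
      using norm_triangle_ineq[of "\<sigma>' *\<^sub>R (x' - xbar')" "\<sigma> *\<^sub>R (x - x')"] \<open>0 < \<sigma>\<close> by simp
    moreover have "\<sigma> * norm (x - x') \<le> \<sigma> * (9 / 8 * a)"
      using z(3) \<open>0 < \<sigma>\<close> by (intro mult_left_mono) auto
    ultimately have v: "norm (\<sigma> *\<^sub>R (x - xbar)) \<le> norm (\<sigma>' *\<^sub>R (x' - xbar')) + 9 / 8 * (\<sigma> * a)"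
      by simp
    have "0 \<le> \<sigma> * a"
      unfolding a_def using \<open>0 < \<sigma>\<close> by simp
    have "norm (grad h x) \<le> norm (\<sigma>' *\<^sub>R (x' - xbar')) + 5 / 2 * \<sigma> * a" if "M \<le> \<sigma>"
    proof -
      have "?hs z \<le> ?hs y" "?hs z \<le> ?hs x"
        using z(1) by (auto simp: is_arg_min_def not_less)
      have "(M + \<sigma>) * (?hs x - ?hs y) \<le> (M + \<sigma>) * (?hs x - ?hs z)"
        using \<open>0 < M\<close> \<open>0 < \<sigma>\<close> \<open>?hs z \<le> ?hs y\<close> by (intro mult_left_mono) auto
      also have "\<dots> \<le> (2 * \<sigma>) * (\<sigma> / 128 * a\<^sup>2)"
        using that z(4) \<open>?hs z \<le> ?hs x\<close> \<open>0 < \<sigma>\<close> by (intro mult_mono) auto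
      also have "\<dots> = 1 / 64 * (\<sigma> * a)\<^sup>2"
        by (simp add: power2_eq_square)
      finally have "3 / 8 * (norm (grad ?hs x))\<^sup>2 \<le> 1 / 64 * (\<sigma> * a)\<^sup>2"
        using y by linarith
      moreover have "(\<sigma> * a / 4)\<^sup>2 = (\<sigma> * a)\<^sup>2 / 16"
        by (simp add: power_divide)
      ultimately have "(norm (grad ?hs x))\<^sup>2 \<le> (\<sigma> * a / 4)\<^sup>2"
        using zero_le_power2[of "\<sigma> * a"] by linarith
      then have "norm (grad ?hs x) \<le> \<sigma> * a / 4"
        by (rule power2_le_imp_le) (use \<open>0 \<le> \<sigma> * a\<close> in simp)
      moreover have "grad h x = grad ?hs x - \<sigma> *\<^sub>R (x - xbar)"
        using grad_regularized[OF smooth_differentiable[OF h]] by simp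
      then have "norm (grad h x) \<le> norm (grad ?hs x) + norm (\<sigma> *\<^sub>R (x - xbar))"
        using norm_triangle_ineq4[of "grad ?hs x" "\<sigma> *\<^sub>R (x - xbar)"] by (simp only:)
      ultimately have "norm (grad h x) \<le> norm (\<sigma>' *\<^sub>R (x' - xbar')) + 5 / 2 * (\<sigma> * a)"
        using v \<open>0 \<le> \<sigma> * a\<close> by linarith
      then show ?thesis by (simp add: mult.assoc)
    qed
    moreover have "\<sigma> * norm (x - z) \<le> \<sigma> * (a / 8)"
      using z(2) \<open>0 < \<sigma>\<close> by (intro mult_left_mono) auto
    then have "norm (\<sigma> *\<^sub>R (x - xbar)) + 10 * (\<sigma> * norm (x - z))
        \<le> norm (\<sigma>' *\<^sub>R (x' - xbar')) + 5 / 2 * (\<sigma> * a)"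
      using v \<open>0 \<le> \<sigma> * a\<close> by linarith
    then have "norm (\<sigma> *\<^sub>R (x - xbar)) + 5 / 2 * (4 * \<sigma>) * norm (x - z)
        \<le> norm (\<sigma>' *\<^sub>R (x' - xbar')) + 5 / 2 * \<sigma> * a"
      by (simp add: mult.assoc)
    ultimately show ?thesis
      using z(1) unfolding a_def by blast
  qed
  show thesis
    by (rule that[OF loop M(2) M_le k bounds])
qed

text \<open>
  The estimates are at most \<open>2 * Lh\<close>, so the loop ends once \<open>\<sigma>\<close> has been multiplied by \<open>4 ^ S\<close>. The
  bound on the evaluations of a round is halved, up to rounding, whenever \<open>\<sigma>\<close> is multiplied by 4; the
  geometric series is at most twice its first term.
\<close>

lemma AR_loop_correct:
  fixes h :: "'a::euclidean_space \<Rightarrow> real"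
  assumes sub: "subroutine_assumption c A" and h: "smooth Lh h" and Lh: "0 < Lh"
    and "0 \<le> \<sigma>'" "\<sigma>' < \<sigma>" "0 < M'" "M' \<le> 4 * Lh" and S: "2 * Lh \<le> 4 ^ S * \<sigma>"
  shows "\<exists>x M N'. AR_loop A h \<sigma>' \<sigma> xbar' x' M' N = Some (x, M, N') \<and> 0 < M \<and> M \<le> 2 * Lh \<and>
           real N' \<le> real N + 2 * real (S + 1) + 16 * sqrt (2 * (c * Lh) / \<sigma>) \<and>
           (\<forall>z'. curvature_at_least 0 h \<longrightarrow> is_arg_min (regularized h \<sigma>' xbar') (\<lambda>_. True) z' \<longrightarrow>
              norm (grad h x) \<le> norm (\<sigma>' *\<^sub>R (x' - xbar')) + 5 / 2 * \<sigma> * norm (x' - z'))"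
  using assms(4-)
proof (induction S arbitrary: \<sigma>' \<sigma> xbar' x' M' N)
  case (0 \<sigma>' \<sigma> xbar' x' M' N)
  obtain x k M xbar where round:
    "AR_loop A h \<sigma>' \<sigma> xbar' x' M' N =
       (if M \<le> \<sigma> then Some (x, M, N + k + 1) else AR_loop A h \<sigma> (4 * \<sigma>) xbar x M (N + k + 1))"
    "0 < M" "M \<le> 2 * Lh" "real k \<le> 1 + 8 * sqrt (2 * (c * Lh) / \<sigma>)"
    "\<And>z'. curvature_at_least 0 h \<Longrightarrow> is_arg_min (regularized h \<sigma>' xbar') (\<lambda>_. True) z' \<Longrightarrow>
       M \<le> \<sigma> \<longrightarrow> norm (grad h x) \<le> norm (\<sigma>' *\<^sub>R (x' - xbar')) + 5 / 2 * \<sigma> * norm (x' - z')"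
    by (rule AR_loop_round[OF sub h Lh 0(1-4), of xbar' x' N]) blast
  have "M \<le> \<sigma>"
    using round(3) 0 by simp
  have "0 \<le> sqrt (2 * (c * Lh) / \<sigma>)"
    using subroutine_constant_nonneg[OF sub] Lh 0 by simp
  then have "real k + 1 \<le> 2 + 16 * sqrt (2 * (c * Lh) / \<sigma>)"
    using round(4) by linarith
  then show ?case
    using round \<open>M \<le> \<sigma>\<close>
    by (intro exI[of _ x] exI[of _ M] exI[of _ "N + k + 1"]) auto
next
  case (Suc S \<sigma>' \<sigma> xbar' x' M' N)
  obtain x k M xbar where round:
    "AR_loop A h \<sigma>' \<sigma> xbar' x' M' N =
       (if M \<le> \<sigma> then Some (x, M, N + k + 1) else AR_loop A h \<sigma> (4 * \<sigma>) xbar x M (N + k + 1))"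
    "0 < M" "M \<le> 2 * Lh" "real k \<le> 1 + 8 * sqrt (2 * (c * Lh) / \<sigma>)"
    and bounds: "\<And>z'. curvature_at_least 0 h \<Longrightarrow> is_arg_min (regularized h \<sigma>' xbar') (\<lambda>_. True) z' \<Longrightarrow>
       (M \<le> \<sigma> \<longrightarrow> norm (grad h x) \<le> norm (\<sigma>' *\<^sub>R (x' - xbar')) + 5 / 2 * \<sigma> * norm (x' - z')) \<and>
       (\<exists>z. is_arg_min (regularized h \<sigma> xbar) (\<lambda>_. True) z \<and>
          norm (\<sigma> *\<^sub>R (x - xbar)) + 5 / 2 * (4 * \<sigma>) * norm (x - z)
            \<le> norm (\<sigma>' *\<^sub>R (x' - xbar')) + 5 / 2 * \<sigma> * norm (x' - z'))"
    by (rule AR_loop_round[OF sub h Lh Suc.prems(1-4), of xbar' x' N]) blast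
  have sqrt_nonneg: "0 \<le> sqrt (2 * (c * Lh) / \<sigma>)"
    using subroutine_constant_nonneg[OF sub] Lh Suc.prems by simp
  show ?case
  proof (cases "M \<le> \<sigma>")
    case True
    moreover have "real k + 1 \<le> 2 + 16 * sqrt (2 * (c * Lh) / \<sigma>)"
      using round(4) sqrt_nonneg by linarith
    ultimately show ?thesis
      using round bounds
      by (intro exI[of _ x] exI[of _ M] exI[of _ "N + k + 1"]) auto
  next
    case False
    have "0 \<le> \<sigma>" "\<sigma> < 4 * \<sigma>" "0 < M" "M \<le> 4 * Lh" "2 * Lh \<le> 4 ^ S * (4 * \<sigma>)"
      using Suc.prems round by auto
    from Suc.IH[OF this, of xbar x "N + k + 1"] obtain y K N' where
      y: "AR_loop A h \<sigma> (4 * \<sigma>) xbar x M (N + k + 1) = Some (y, K, N')" "0 < K" "K \<le> 2 * Lh"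
        "real N' \<le> real (N + k + 1) + 2 * real (S + 1) + 16 * sqrt (2 * (c * Lh) / (4 * \<sigma>))"
      and grad_y: "\<And>z. curvature_at_least 0 h \<Longrightarrow> is_arg_min (regularized h \<sigma> xbar) (\<lambda>_. True) z \<Longrightarrow>
              norm (grad h y) \<le> norm (\<sigma> *\<^sub>R (x - xbar)) + 5 / 2 * (4 * \<sigma>) * norm (x - z)"
      by blast
    have "sqrt (2 * (c * Lh) / (4 * \<sigma>)) = sqrt (2 * (c * Lh) / \<sigma>) / 2"
    proof -
      have "2 * (c * Lh) / (4 * \<sigma>) = (2 * (c * Lh) / \<sigma>) / 2\<^sup>2"
        by simp
      then show ?thesis
        by (simp only: real_sqrt_divide) simp
    qed
    then have "real N' \<le> real N + 2 * real (Suc S + 1) + 16 * sqrt (2 * (c * Lh) / \<sigma>)"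
      using y(4) round(4) by simp
    moreover have "norm (grad h y) \<le> norm (\<sigma>' *\<^sub>R (x' - xbar')) + 5 / 2 * \<sigma> * norm (x' - z')"
      if "curvature_at_least 0 h" "is_arg_min (regularized h \<sigma>' xbar') (\<lambda>_. True) z'" for z'
      using bounds[OF that] grad_y[OF that(1)] by (meson order_trans)
    ultimately show ?thesis
      using y(1-3) round(1) False by (intro exI[of _ y] exI[of _ K] exI[of _ N']) auto
  qed
qed

text \<open>
  The first round starts with no regularization, so the potential starts at \<open>5 / 2 * (\<mu> / 10)\<close> times
  the distance from \<open>x0\<close> to the minimizer of \<open>h\<close>. Strong convexity bounds that distance by the norm of
  the gradient over \<open>\<mu>\<close>, which gives the factor \<open>1 / 4\<close>.
\<close>

lemma AR_correct:
  fixes h :: "'a::euclidean_space \<Rightarrow> real"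
  assumes sub: "subroutine_assumption c A" and h: "smooth Lh h" and Lh: "0 < Lh"
    and \<mu>: "0 < \<mu>" and M0: "0 < M0" "M0 \<le> 4 * Lh" and S: "2 * Lh \<le> 4 ^ S * (\<mu> / 10)"
  shows "\<exists>x M N. AR A h x0 (\<mu> / 10) M0 = Some (x, M, N) \<and> 0 < M \<and> M \<le> 2 * Lh \<and>
           real N \<le> 2 * real (S + 1) + 16 * sqrt (2 * (c * Lh) / (\<mu> / 10)) \<and>
           (curvature_at_least \<mu> h \<longrightarrow> norm (grad h x) \<le> norm (grad h x0) / 4)"
proof -
  have h0: "regularized h 0 x0 = h"
    by (simp add: fun_eq_iff regularized_def)
  obtain x M N where x: "AR A h x0 (\<mu> / 10) M0 = Some (x, M, N)" "0 < M" "M \<le> 2 * Lh"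
      "real N \<le> 2 * real (S + 1) + 16 * sqrt (2 * (c * Lh) / (\<mu> / 10))"
    and grad_x: "\<And>z. curvature_at_least 0 h \<Longrightarrow> is_arg_min h (\<lambda>_. True) z \<Longrightarrow>
        norm (grad h x) \<le> 5 / 2 * (\<mu> / 10) * norm (x0 - z)"
    using AR_loop_correct[OF sub h Lh _ _ M0 S, of 0 x0 x0 0] \<mu> unfolding AR_def h0 by auto
  have "norm (grad h x) \<le> norm (grad h x0) / 4" if curv: "curvature_at_least \<mu> h"
  proof -
    note dh = smooth_differentiable[OF h]
    obtain z where z: "is_arg_min h (\<lambda>_. True) z"
      using arg_min_exists[OF dh \<mu> curv] by blast
    have "curvature_at_least 0 h"
      using curv \<mu> by (intro curvature_at_least_mono[OF curv]) simp
    from grad_x[OF this z] dist_arg_min_le_grad[OF dh z curv, of x0] show ?thesis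
      by simp
  qed
  with x show ?thesis by blast
qed

section \<open>Gradient halving\<close>

lemma log_pos: "0 < log b u" if "1 < b" "1 < u" for b u :: real
  using that by simp

text \<open>
  Every step that does not end the loop halves the gradient, which bounds the number of steps even
  for nonconvex \<open>h\<close>. If \<open>h\<close> is \<open>\<mu>\<close>-strongly convex, each step contracts the gradient by 4 and the error
  test cannot succeed. The bound \<open>K\<close> on the cost of a step includes the evaluation for the stopping
  test.
\<close>

lemma SCAR_PM_loop_correct:
  fixes h :: "'a::euclidean_space \<Rightarrow> real"
  assumes sub: "subroutine_assumption c A" and h: "smooth Lh h" and Lh: "0 < Lh"
    and \<mu>: "0 < \<mu>" and \<epsilon>: "0 < \<epsilon>" and S: "2 * Lh \<le> 4 ^ S * (\<mu> / 10)"
    and K: "2 * real (S + 1) + 16 * sqrt (2 * (c * Lh) / (\<mu> / 10)) + 1 \<le> K"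
    and M': "0 < M'" "M' \<le> 4 * Lh" and y': "\<epsilon> < norm (grad h y')"
  shows "\<exists>x M e N'. SCAR_PM_loop A h \<epsilon> y0 \<mu> y' M' N = Some (x, M, e, N') \<and> 0 < M \<and> M \<le> 2 * Lh \<and>
           real N' \<le> real N + K * (1 + log 2 (norm (grad h y') / \<epsilon>)) \<and>
           (if e then x = y0 else norm (grad h x) \<le> \<epsilon>) \<and> (curvature_at_least \<mu> h \<longrightarrow> \<not> e)"
proof -
  have "0 \<le> 16 * sqrt (2 * (c * Lh) / (\<mu> / 10))"
    using subroutine_constant_nonneg[OF sub] Lh \<mu> by simp
  then have "0 < K"
    using K by linarith
  obtain n where "norm (grad h y') / \<epsilon> < 2 ^ n"
    using real_arch_pow[of 2] by auto
  then have "norm (grad h y') \<le> 2 ^ n * \<epsilon>"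
    using \<epsilon> by (simp add: field_simps)
  with M' y' show ?thesis
  proof (induction n arbitrary: y' M' N)
    case (0 y' M' N)
    then show ?case by simp
  next
    case (Suc n y' M' N)
    obtain y M k where AR: "AR A h y' (\<mu> / 10) M' = Some (y, M, k)" and M: "0 < M" "M \<le> 2 * Lh"
      and k: "real k + 1 \<le> K"
      and contraction: "curvature_at_least \<mu> h \<Longrightarrow> norm (grad h y) \<le> norm (grad h y') / 4"
      using AR_correct[OF sub h Lh \<mu> Suc.prems(1,2) S, of y'] K by force
    have "0 < log 2 (norm (grad h y') / \<epsilon>)"
      using Suc.prems(3) \<epsilon> by (intro log_pos) auto
    then have "K \<le> K * (1 + log 2 (norm (grad h y') / \<epsilon>))"
      using \<open>0 < K\<close> by simp
    then have N: "real (N + k + 1) \<le> real N + K * (1 + log 2 (norm (grad h y') / \<epsilon>))"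
      unfolding of_nat_add of_nat_1 using k by linarith
    consider (small) "norm (grad h y) \<le> \<epsilon>"
      | (error) "\<epsilon> < norm (grad h y)" "norm (grad h y') / 2 < norm (grad h y)"
      | (continue) "\<epsilon> < norm (grad h y)" "norm (grad h y) \<le> norm (grad h y') / 2"
      by linarith
    then show ?case
    proof cases
      case small
      then have "SCAR_PM_loop A h \<epsilon> y0 \<mu> y' M' N = Some (y, M, False, N + k + 1)"
        by (subst SCAR_PM_loop.simps) (simp add: AR)
      then show ?thesis
        using M N small by auto
    next
      case error
      then have "SCAR_PM_loop A h \<epsilon> y0 \<mu> y' M' N = Some (y0, M, True, N + k + 1)"
        by (subst SCAR_PM_loop.simps) (simp add: AR)
      moreover have "\<not> curvature_at_least \<mu> h"
        using contraction error Suc.prems(3) \<epsilon> by force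
      ultimately show ?thesis
        using M N by auto
    next
      case continue
      then have loop: "SCAR_PM_loop A h \<epsilon> y0 \<mu> y' M' N = SCAR_PM_loop A h \<epsilon> y0 \<mu> y M (N + k + 1)"
        by (subst SCAR_PM_loop.simps) (simp add: AR)
      have "0 < norm (grad h y)"
        using continue(1) \<epsilon> by linarith
      have "log 2 (norm (grad h y) / \<epsilon>) \<le> log 2 ((norm (grad h y') / \<epsilon>) / 2)"
        using continue(2) \<epsilon> \<open>0 < norm (grad h y)\<close>
        by (intro log_mono) (auto simp: field_simps)
      also have "\<dots> = log 2 (norm (grad h y') / \<epsilon>) - 1"
        using Suc.prems(3) \<epsilon> by (subst log_divide) auto
      finally have "K * (1 + log 2 (norm (grad h y) / \<epsilon>)) \<le> K * log 2 (norm (grad h y') / \<epsilon>)"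
        using \<open>0 < K\<close> by (intro mult_left_mono) auto
      then have "real (N + k + 1) + K * (1 + log 2 (norm (grad h y) / \<epsilon>))
          \<le> real N + K * (1 + log 2 (norm (grad h y') / \<epsilon>))"
        using k by (simp add: distrib_left)
      moreover have "M \<le> 4 * Lh" "norm (grad h y) \<le> 2 ^ n * \<epsilon>"
        using M(2) Lh continue(2) Suc.prems(4) by auto
      from Suc.IH[OF M(1) this(1) continue(1) this(2), of "N + k + 1"]
      obtain x M'' e N' where "SCAR_PM_loop A h \<epsilon> y0 \<mu> y M (N + k + 1) = Some (x, M'', e, N')"
         "0 < M''" "M'' \<le> 2 * Lh" "real N' \<le> real (N + k + 1) + K * (1 + log 2 (norm (grad h y) / \<epsilon>))"
         "if e then x = y0 else norm (grad h x) \<le> \<epsilon>" "curvature_at_least \<mu> h \<longrightarrow> \<not> e"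
        by blast
      ultimately show ?thesis
        unfolding loop by (intro exI[of _ x] exI[of _ M''] exI[of _ e] exI[of _ N']) auto
    qed
  qed
qed

section \<open>One outer iteration\<close>

text \<open>
  The gradient of \<open>f\<close> at \<open>x\<close> differs from the small gradient of the regularized function by
  \<open>2 * \<rho>\<close> times \<open>x - x'\<close>, so \<open>x\<close> has moved far from \<open>x'\<close>. Both the proximal term and strong convexity
  turn this distance into a decrease of \<open>f\<close>.
\<close>

lemma sufficient_decrease:
  fixes f :: "'a::euclidean_space \<Rightarrow> real"
  assumes diff: "\<And>u. f differentiable (at u)" and \<rho>: "0 < \<rho>"
    and curv: "curvature_at_least \<rho> (regularized f (2 * \<rho>) x')"
    and small: "norm (grad (regularized f (2 * \<rho>) x') x) \<le> norm (grad f x) / 4"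
  shows "(norm (grad f x))\<^sup>2 \<le> 10 * \<rho> * (f x' - f x)"
proof -
  let ?F = "regularized f (2 * \<rho>) x'"
  define G q where "G = norm (grad f x)" and "q = \<rho> * norm (x - x')"
  have "grad f x = grad ?F x - (2 * \<rho>) *\<^sub>R (x - x')"
    using grad_regularized[OF diff] by simp
  then have "G \<le> norm (grad ?F x) + norm ((2 * \<rho>) *\<^sub>R (x - x'))"
    unfolding G_def using norm_triangle_ineq4 by metis
  then have q: "3 / 8 * G \<le> q"
    using small \<rho> unfolding G_def q_def by simp
  have "?F x + grad ?F x \<bullet> (x' - x) + \<rho> / 2 * (norm (x' - x))\<^sup>2 \<le> ?F x'"
    using curv by (rule curvature_at_leastD)
  moreover have "- (grad ?F x \<bullet> (x' - x)) \<le> norm (grad ?F x) * norm (x' - x)"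
    using Cauchy_Schwarz_ineq2[of "grad ?F x" "x' - x"] by linarith
  moreover have "norm (grad ?F x) * norm (x' - x) \<le> G / 4 * norm (x' - x)"
    using small unfolding G_def by (intro mult_right_mono) auto
  ultimately have "3 / 2 * \<rho> * (norm (x - x'))\<^sup>2 - G / 4 * norm (x - x') \<le> f x' - f x"
    unfolding regularized_def by (simp add: norm_minus_commute)
  then have "10 * \<rho> * (3 / 2 * \<rho> * (norm (x - x'))\<^sup>2 - G / 4 * norm (x - x')) \<le> 10 * \<rho> * (f x' - f x)"
    using \<rho> by (intro mult_left_mono) auto
  moreover have "10 * \<rho> * (3 / 2 * \<rho> * (norm (x - x'))\<^sup>2 - G / 4 * norm (x - x')) = 15 * q\<^sup>2 - 5 / 2 * G * q"
    unfolding q_def by (simp add: power2_eq_square algebra_simps)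
  \<comment> \<open>The right-hand side minus \<open>75 / 64 * G\<^sup>2\<close> factors, with the root \<open>3 / 8 * G\<close>, the lower bound for \<open>q\<close>.\<close>
  moreover have "G\<^sup>2 \<le> 15 * q\<^sup>2 - 5 / 2 * G * q"
  proof -
    have "0 \<le> G" unfolding G_def by simp
    then have "0 \<le> (q - 3 / 8 * G) * (15 * q + 25 / 8 * G)"
      using q by (intro mult_nonneg_nonneg) auto
    moreover have "(q - 3 / 8 * G) * (15 * q + 25 / 8 * G) = 15 * q\<^sup>2 - 5 / 2 * G * q - 75 / 64 * G\<^sup>2"
      by (simp add: power2_eq_square field_simps)
    ultimately show ?thesis
      using zero_le_power2[of G] by linarith
  qed
  ultimately show ?thesis
    unfolding G_def by linarith
qed

lemma double_le_power2: "2 * n \<le> 2 ^ n" for n :: nat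
proof (induction n)
  case (Suc n)
  then show ?case by (cases n) auto
qed simp

text \<open>
  For \<open>r\<close> the ratio of the smoothness constant to the initial regularization, \<open>S + 1\<close> rounds suffice
  by \<open>AR_loop_correct\<close>. Their fixed costs, and the evaluations for the stopping tests, are logarithmic
  in \<open>r\<close> and are absorbed by the summand 3 in the constant \<open>C1\<close>; this needs \<open>r\<close> bounded away
  from 1.
\<close>

lemma rounds_bound:
  fixes r :: real
  assumes "45 / 2 \<le> r"
  obtains S :: nat where "2 * r \<le> 4 ^ S" "2 * real S + 4 \<le> 3 * sqrt r"
proof -
  define q where "q = sqrt r"
  have "4 \<le> q"
    unfolding q_def using assms by (intro real_le_rsqrt) auto
  have "sqrt 2 \<le> 3 / 2"
    by (rule real_le_lsqrt) (auto simp: power2_eq_square)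
  then have sqrt2: "sqrt 2 * q \<le> 3 / 2 * q"
    using \<open>4 \<le> q\<close> by (intro mult_right_mono) auto
  obtain m where "sqrt 2 * q < 2 ^ m"
    using real_arch_pow[of 2] by auto
  then obtain S where S: "sqrt 2 * q \<le> 2 ^ S" and least: "\<And>i. i < S \<Longrightarrow> \<not> sqrt 2 * q \<le> 2 ^ i"
    using ex_least_nat_le[of "\<lambda>i. sqrt 2 * q \<le> 2 ^ i" m] by (metis less_imp_le)
  have "(sqrt 2 * q)\<^sup>2 \<le> (2 ^ S)\<^sup>2"
    using S \<open>4 \<le> q\<close> by (intro power_mono) auto
  moreover have "(sqrt 2 * q)\<^sup>2 = 2 * r"
    unfolding q_def using assms by (simp add: power_mult_distrib)
  moreover have "(2 ^ S)\<^sup>2 = (4 :: real) ^ S"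
    by (simp add: power2_eq_square flip: power_mult_distrib)
  ultimately have "2 * r \<le> 4 ^ S"
    by simp
  moreover have "2 * real S + 4 \<le> 3 * q"
  proof (cases S)
    case 0
    then show ?thesis using \<open>4 \<le> q\<close> by simp
  next
    case (Suc n)
    have "2 * real n \<le> 2 ^ n"
      using of_nat_mono[OF double_le_power2[of n], where 'a = real] by simp
    moreover have "2 ^ n < sqrt 2 * q"
      using least[of n] Suc by simp
    moreover have "real S = real n + 1"
      using Suc by simp
    ultimately show ?thesis
      using sqrt2 \<open>4 \<le> q\<close> by linarith
  qed
  ultimately show thesis
    using that unfolding q_def by blast
qed

lemma log2_le: "log 2 u \<le> 3 / 2 * (u - 1)" if "1 \<le> u" for u :: real
proof -
  have "ln u \<le> u - 1"
    using that by (intro ln_le_minus_one) auto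
  moreover have "u - 1 \<le> 3 / 2 * (u - 1) * ln 2"
    using mult_left_mono[OF ln2_ge_two_thirds, of "3 / 2 * (u - 1)"] that by simp
  ultimately have "ln u / ln 2 \<le> 3 / 2 * (u - 1)"
    by (simp add: pos_divide_le_eq)
  then show ?thesis by (simp add: log_def)
qed

text \<open>
  With \<open>u\<close> the norm of the gradient over \<open>\<epsilon>\<close>, this lets the guaranteed decrease of the objective, which
  is quadratic in the gradient, pay for the logarithmic number of steps of the next iteration.
\<close>

lemma log_term_le_square: "1 + log 2 (4 * u) \<le> 3 * u\<^sup>2" if "1 \<le> u" for u :: real
proof -
  have "log 2 (4 * u) = log 2 4 + log 2 u"
    using that by (simp add: log_mult)
  moreover have "log 2 (2 ^ 2) = (2 :: real)"
    by (subst log_pow_cancel) auto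
  then have "log 2 4 = (2 :: real)"
    by simp
  moreover have "0 \<le> (u - 1) * (3 * u + 3 / 2)"
    using that by (intro mult_nonneg_nonneg) auto
  then have "3 / 2 * (u - 1) + 3 \<le> 3 * u\<^sup>2"
    by (simp add: power2_eq_square field_simps)
  ultimately show ?thesis
    using log2_le[OF that] by linarith
qed

text \<open>
  Since \<open>\<rho> < 4 * l\<close>, the ratio \<open>r\<close> of the smoothness constant of the regularized function to the initial
  regularization \<open>\<rho> / 10\<close> is at least \<open>45 / 2\<close>. When \<open>l \<le> \<rho>\<close>, the curvature of the
  regularized function is at least \<open>2 * \<rho> - l \<ge> \<rho>\<close>, so that the iteration makes progress.
\<close>

lemma NASCAR_iteration:
  fixes f :: "'a::euclidean_space \<Rightarrow> real"
  assumes sub: "subroutine_assumption c A" and f: "smooth L f"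
    and curv: "lower_curvature l f" and l: "0 < l" "l \<le> L" and \<epsilon>: "0 < \<epsilon>"
    and \<rho>: "0 < \<rho>" "\<rho> < 4 * l" and M': "0 < M'" "M' \<le> 4 * (L + 2 * \<rho>)"
    and x': "\<epsilon> < norm (grad f x')"
  obtains x M e k where
    "SCAR_PM A (\<lambda>z. f z + \<rho> * (norm (z - x'))\<^sup>2) (\<epsilon> / 4) x' \<rho> M' = Some (x, M, e, k)"
    "0 < M" "M \<le> 4 * (L + 2 * \<rho>)" "e \<Longrightarrow> x = x'"
    "real k + 1 \<le> (3 + 16 * sqrt (2 * c)) * sqrt 10 * sqrt (L / \<rho> + 2)
                    * (1 + log 2 (4 * norm (grad f x') / \<epsilon>))"
    "l \<le> \<rho> \<Longrightarrow> \<epsilon> < norm (grad f x) \<Longrightarrow>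
       \<not> e \<and> (norm (grad f x))\<^sup>2 \<le> 10 * \<rho> * (f x' - f x)"
proof -
  let ?F = "regularized f (2 * \<rho>) x'"
  note df = smooth_differentiable[OF f]
  define LF where "LF = L + 2 * \<rho>"
  have F: "(\<lambda>z. f z + \<rho> * (norm (z - x'))\<^sup>2) = ?F"
    by (simp add: fun_eq_iff regularized_def)
  have smooth_F: "smooth LF ?F"
    unfolding LF_def using f \<rho> by (intro smooth_regularized) auto
  have "0 < LF"
    unfolding LF_def using l \<rho> by simp
  have grad_x': "grad ?F x' = grad f x'"
    using grad_regularized[OF df] by simp
  define r where "r = 10 * (L / \<rho> + 2)"
  \<comment> \<open>The largest possible \<open>\<rho>\<close> is below \<open>4 * l \<le> 4 * L\<close>, whence the bound 45/2.\<close>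
  have "1 / 4 \<le> L / \<rho>"
    using \<rho> l by (simp add: field_simps)
  then have "45 / 2 \<le> r"
    unfolding r_def by simp
  obtain S where S: "2 * r \<le> 4 ^ S" "2 * real S + 4 \<le> 3 * sqrt r"
    using rounds_bound[OF \<open>45 / 2 \<le> r\<close>] .
  have LF_r: "LF = r * (\<rho> / 10)"
    unfolding LF_def r_def using \<rho> by (simp add: field_simps)
  have S': "2 * LF \<le> 4 ^ S * (\<rho> / 10)"
    unfolding LF_r using mult_right_mono[OF S(1), of "\<rho> / 10"] \<rho> by simp
  define K where "K = 2 * real (S + 1) + 16 * sqrt (2 * (c * LF) / (\<rho> / 10)) + 1"
  define \<tau> where "\<tau> = 1 + log 2 (4 * norm (grad f x') / \<epsilon>)"
  have ratio: "norm (grad ?F x') / (\<epsilon> / 4) = 4 * norm (grad f x') / \<epsilon>"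
    unfolding grad_x' by simp
  have \<epsilon>4: "0 < \<epsilon> / 4" "\<epsilon> / 4 < norm (grad ?F x')"
    using \<epsilon> x' unfolding grad_x' by auto
  have "M' \<le> 4 * LF"
    using M'(2) unfolding LF_def .
  from SCAR_PM_loop_correct[OF sub smooth_F \<open>0 < LF\<close> \<rho>(1) \<epsilon>4(1) S' order_refl M'(1) this \<epsilon>4(2),
      of x' 1, folded SCAR_PM_def K_def, unfolded ratio, folded \<tau>_def]
  obtain x M e k where
    run: "SCAR_PM A ?F (\<epsilon> / 4) x' \<rho> M' = Some (x, M, e, k)"
    and M: "0 < M" "M \<le> 2 * LF" and k: "real k \<le> real 1 + K * \<tau>"
    and x: "if e then x = x' else norm (grad ?F x) \<le> \<epsilon> / 4"
    and no_error: "curvature_at_least \<rho> ?F \<longrightarrow> \<not> e"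
    by blast
  have "2 \<le> \<tau>"
  proof -
    have "log 2 2 \<le> log 2 (4 * norm (grad f x') / \<epsilon>)"
      using x' \<epsilon> by (intro log_mono) (auto simp: field_simps)
    then show ?thesis unfolding \<tau>_def by simp
  qed
  have "real k + 1 \<le> (K + 1) * \<tau>"
    using k \<open>2 \<le> \<tau>\<close> unfolding distrib_right by simp
  also have "K + 1 \<le> (3 + 16 * sqrt (2 * c)) * sqrt r"
  proof -
    have "2 * (c * LF) / (\<rho> / 10) = (2 * c) * r"
      unfolding LF_r using \<rho> by simp
    then have "sqrt (2 * (c * LF) / (\<rho> / 10)) = sqrt (2 * c) * sqrt r"
      by (simp only: real_sqrt_mult)
    then have "K + 1 = 2 * real S + 4 + 16 * (sqrt (2 * c) * sqrt r)"
      unfolding K_def by (simp only:) simp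
    also have "\<dots> \<le> 3 * sqrt r + 16 * (sqrt (2 * c) * sqrt r)"
      using S(2) by (rule add_right_mono)
    also have "\<dots> = (3 + 16 * sqrt (2 * c)) * sqrt r"
      by (simp only: distrib_right mult.assoc)
    finally show ?thesis .
  qed
  then have "(K + 1) * \<tau> \<le> (3 + 16 * sqrt (2 * c)) * sqrt r * \<tau>"
    using \<open>2 \<le> \<tau>\<close> by (intro mult_right_mono) auto
  also have "sqrt r = sqrt 10 * sqrt (L / \<rho> + 2)"
    unfolding r_def by (rule real_sqrt_mult)
  finally have cost: "real k + 1 \<le> (3 + 16 * sqrt (2 * c)) * sqrt 10 * sqrt (L / \<rho> + 2) * \<tau>"
    by (simp only: mult.assoc)
  have success: "\<not> e \<and> (norm (grad f x))\<^sup>2 \<le> 10 * \<rho> * (f x' - f x)"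
    if "l \<le> \<rho>" "\<epsilon> < norm (grad f x)"
  proof -
    have "curvature_at_least (- l + 2 * \<rho>) ?F"
      using lower_curvature_imp_curvature_at_least[OF df curv]
      by (rule curvature_at_least_regularized[OF df, THEN iffD2])
    then have curv_F: "curvature_at_least \<rho> ?F"
      by (rule curvature_at_least_mono) (use \<open>l \<le> \<rho>\<close> in simp)
    then have "\<not> e"
      using no_error by blast
    then have "norm (grad ?F x) \<le> \<epsilon> / 4"
      using x by (simp only: if_False)
    then have "norm (grad ?F x) \<le> norm (grad f x) / 4"
      using that(2) by linarith
    from sufficient_decrease[OF df \<rho>(1) curv_F this] \<open>\<not> e\<close> show ?thesis
      by blast
  qed
  have "M \<le> 4 * (L + 2 * \<rho>)"
    using M \<open>0 < LF\<close> unfolding LF_def by simp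
  moreover have "x = x'" if e
    using x that by simp
  ultimately show thesis
    using cost success unfolding \<tau>_def by (intro that[OF run[folded F] M(1)])
qed

section \<open>The total number of gradient evaluations\<close>

text \<open>
  The induction is on a bound for the sum of the scaled remaining decrease and the remaining number of
  increases of \<open>\<rho>\<close>; each iteration that goes on lowers it by at least 1. The bound on the evaluations is
  a potential. Its first part pays for all iterations from the current point: increasing \<open>\<rho>\<close> to
  \<open>4 * \<rho>\<close> halves it, and the half that is set free covers the iteration because \<open>\<rho> < l\<close>. On
  progress the first part for the new point is charged to the decrease of the objective.
\<close>

lemma NASCAR_loop_correct:
  fixes f :: "'a::euclidean_space \<Rightarrow> real"
  assumes sub: "subroutine_assumption c A" and f: "smooth L f"
    and curv: "lower_curvature l f" and l: "0 < l" "l \<le> L" and \<epsilon>: "0 < \<epsilon>"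
    and lower: "\<And>x. fmin \<le> f x" and \<kappa>: "\<kappa> = (3 + 16 * sqrt (2 * c)) * sqrt 10"
    and \<rho>: "0 < \<rho>" "\<rho> < 4 * l" and M': "0 < M'" "M' \<le> 4 * (L + 2 * \<rho>)"
    and x': "\<epsilon> < norm (grad f x')"
  shows "\<exists>x N'. NASCAR_loop A f \<epsilon> x' \<rho> M' N = Some (x, N') \<and> norm (grad f x) \<le> \<epsilon> \<and>
           real N' \<le> real N
             + \<kappa> * (2 * sqrt 3) * sqrt (L / \<rho>) * (1 + log 2 (4 * norm (grad f x') / \<epsilon>))
             + \<kappa> * (120 * sqrt 3) * (sqrt (L * l) * (f x' - fmin) / \<epsilon>\<^sup>2)"
proof -
  have "0 < L" using l by simp
  have "0 \<le> \<kappa>"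
    unfolding \<kappa> using subroutine_constant_nonneg[OF sub] by simp
  obtain n where "(f x' - fmin) * (40 * l / \<epsilon>\<^sup>2) + log 4 (4 * l / \<rho>) \<le> real n"
    using real_arch_simple by blast
  with \<rho> M' x' show ?thesis
  proof (induction n arbitrary: x' \<rho> M' N)
    case (0 x' \<rho> M' N)
    have "0 \<le> (f x' - fmin) * (40 * l / \<epsilon>\<^sup>2)"
      using lower[of x'] l by (intro mult_nonneg_nonneg) auto
    moreover have "0 < log 4 (4 * l / \<rho>)"
      using 0 by (intro log_pos) auto
    moreover have "(f x' - fmin) * (40 * l / \<epsilon>\<^sup>2) + log 4 (4 * l / \<rho>) \<le> 0"
      using 0 by simp
    ultimately show ?case
      by linarith
  next
    case (Suc n x' \<rho> M' N)
    note \<rho> = Suc.prems(1,2)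
    define \<tau> where "\<tau> = 1 + log 2 (4 * norm (grad f x') / \<epsilon>)"
    define D where "D = f x' - fmin"
    obtain x M e k where
      run: "SCAR_PM A (\<lambda>z. f z + \<rho> * (norm (z - x'))\<^sup>2) (\<epsilon> / 4) x' \<rho> M' = Some (x, M, e, k)"
      and M: "0 < M" "M \<le> 4 * (L + 2 * \<rho>)" and e: "e \<Longrightarrow> x = x'"
      and k: "real k + 1 \<le> \<kappa> * sqrt (L / \<rho> + 2) * \<tau>"
      and success: "l \<le> \<rho> \<Longrightarrow> \<epsilon> < norm (grad f x) \<Longrightarrow>
         \<not> e \<and> (norm (grad f x))\<^sup>2 \<le> 10 * \<rho> * (f x' - f x)"
      using NASCAR_iteration[OF sub f curv l \<epsilon> Suc.prems(1-5)] unfolding \<kappa> \<tau>_def by blast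
    have "0 < \<tau>"
    proof -
      have "0 < log 2 (4 * norm (grad f x') / \<epsilon>)"
        using Suc.prems(5) \<epsilon> by (intro log_pos) (auto simp: field_simps)
      then show ?thesis unfolding \<tau>_def by simp
    qed
    have "0 \<le> D"
      unfolding D_def using lower[of x'] by simp
    have sqrt_le: "sqrt (L / \<rho> + 2) \<le> w * sqrt (L / \<rho>)" if "\<rho> * 2 \<le> (w\<^sup>2 - 1) * L" "0 \<le> w" for w
    proof -
      have "L / \<rho> + 2 = (L + \<rho> * 2) / \<rho>"
        using \<rho> by (simp add: field_simps)
      also have "\<dots> \<le> (w\<^sup>2 * L) / \<rho>"
        using that(1) \<rho> by (intro divide_right_mono) (auto simp: left_diff_distrib)
      finally have "L / \<rho> + 2 \<le> w\<^sup>2 * (L / \<rho>)"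
        by simp
      then have "sqrt (L / \<rho> + 2) \<le> sqrt (w\<^sup>2 * (L / \<rho>))"
        by (rule real_sqrt_le_mono)
      also have "\<dots> = w * sqrt (L / \<rho>)"
        using that(2) by (simp only: real_sqrt_mult real_sqrt_abs abs_of_nonneg)
      finally show ?thesis .
    qed
    \<comment> \<open>Here \<open>\<rho>\<close> may be close to \<open>4 * L\<close>: then \<open>L / \<rho> + 2\<close> is close to \<open>9 * (L / \<rho>)\<close>, still below \<open>12 * (L / \<rho>)\<close>.\<close>
    have cost: "real k + 1 \<le> \<kappa> * (2 * sqrt 3) * sqrt (L / \<rho>) * \<tau>"
    proof -
      have "sqrt (L / \<rho> + 2) \<le> (2 * sqrt 3) * sqrt (L / \<rho>)"
        using \<rho> l by (intro sqrt_le) (auto simp: power_mult_distrib)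
      then have "\<kappa> * sqrt (L / \<rho> + 2) * \<tau> \<le> \<kappa> * ((2 * sqrt 3) * sqrt (L / \<rho>)) * \<tau>"
        using \<open>0 \<le> \<kappa>\<close> \<open>0 < \<tau>\<close> by (intro mult_right_mono mult_left_mono) auto
      then show ?thesis
        using k by (simp add: mult.assoc)
    qed
    have D_term: "0 \<le> \<kappa> * (120 * sqrt 3) * (sqrt (L * l) * D / \<epsilon>\<^sup>2)"
      using \<open>0 \<le> \<kappa>\<close> \<open>0 \<le> D\<close> \<open>0 < L\<close> l by (intro mult_nonneg_nonneg divide_nonneg_nonneg) auto
    consider (final) "norm (grad f x) \<le> \<epsilon>"
      | (increase) "\<epsilon> < norm (grad f x)" "e \<or> 10 * \<rho> * (f x' - f x) < (norm (grad f x))\<^sup>2"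
      | (progress) "\<epsilon> < norm (grad f x)" "\<not> e" "(norm (grad f x))\<^sup>2 \<le> 10 * \<rho> * (f x' - f x)"
      by linarith
    then show ?case
    proof cases
      case final
      then have "NASCAR_loop A f \<epsilon> x' \<rho> M' N = Some (x, N + k + 1)"
        by (subst NASCAR_loop.simps) (simp add: run)
      then show ?thesis
        using final cost D_term unfolding \<tau>_def D_def by simp
    next
      case increase
      then have loop: "NASCAR_loop A f \<epsilon> x' \<rho> M' N = NASCAR_loop A f \<epsilon> x' (4 * \<rho>) M (N + k + 1)"
        by (subst NASCAR_loop.simps) (auto simp add: run)
      \<comment> \<open>For \<open>\<rho> \<ge> l\<close> the iteration would have been accepted, so the next \<open>\<rho>\<close> stays below \<open>4 * l\<close>.\<close>
      have "\<rho> < l"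
        using success increase by force
      have "log 4 (4 * l / (4 * \<rho>)) = log 4 (4 * l / \<rho>) - 1"
        using \<rho> l by (simp add: log_divide log_mult)
      then have "(f x' - fmin) * (40 * l / \<epsilon>\<^sup>2) + log 4 (4 * l / (4 * \<rho>)) \<le> real n"
        using Suc.prems(6) by simp
      moreover have "0 < 4 * \<rho>" "4 * \<rho> < 4 * l" "M \<le> 4 * (L + 2 * (4 * \<rho>))"
        using \<rho> \<open>\<rho> < l\<close> M by auto
      ultimately obtain y N' where y: "NASCAR_loop A f \<epsilon> x' (4 * \<rho>) M (N + k + 1) = Some (y, N')"
        "norm (grad f y) \<le> \<epsilon>"
        and N': "real N' \<le> real (N + k + 1) + \<kappa> * (2 * sqrt 3) * sqrt (L / (4 * \<rho>)) * \<tau>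
             + \<kappa> * (120 * sqrt 3) * (sqrt (L * l) * D / \<epsilon>\<^sup>2)"
        using Suc.IH[of "4 * \<rho>" M x' "N + k + 1"] M(1) Suc.prems(5) unfolding \<tau>_def D_def by blast
      have "sqrt (L / (4 * \<rho>)) = sqrt (L / \<rho>) / 2"
        by (simp add: real_sqrt_divide real_sqrt_mult)
      then have half: "\<kappa> * (2 * sqrt 3) * sqrt (L / (4 * \<rho>)) * \<tau> = \<kappa> * (sqrt 3 * sqrt (L / \<rho>)) * \<tau>"
        by simp
      have "sqrt (L / \<rho> + 2) \<le> sqrt 3 * sqrt (L / \<rho>)"
        using \<rho> l \<open>\<rho> < l\<close> by (intro sqrt_le) auto
      then have "\<kappa> * sqrt (L / \<rho> + 2) * \<tau> \<le> \<kappa> * (sqrt 3 * sqrt (L / \<rho>)) * \<tau>"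
        using \<open>0 \<le> \<kappa>\<close> \<open>0 < \<tau>\<close> by (intro mult_right_mono mult_left_mono) auto
      moreover have "\<kappa> * (2 * sqrt 3) * sqrt (L / \<rho>) * \<tau> = 2 * (\<kappa> * (sqrt 3 * sqrt (L / \<rho>)) * \<tau>)"
        by simp
      ultimately have "real N' \<le> real N + \<kappa> * (2 * sqrt 3) * sqrt (L / \<rho>) * \<tau>
             + \<kappa> * (120 * sqrt 3) * (sqrt (L * l) * D / \<epsilon>\<^sup>2)"
        using N' k half by simp
      then show ?thesis
        using y unfolding loop \<tau>_def D_def by blast
    next
      case progress
      then have loop: "NASCAR_loop A f \<epsilon> x' \<rho> M' N = NASCAR_loop A f \<epsilon> x \<rho> M (N + k + 1)"
        by (subst NASCAR_loop.simps) (simp add: run)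
      define \<Delta> where "\<Delta> = f x' - f x"
      define G where "G = norm (grad f x)"
      \<comment> \<open>The decrease \<open>\<Delta>\<close> is at least \<open>\<epsilon>\<^sup>2 / (40 * l)\<close>, one unit of the induction measure.\<close>
      have "\<epsilon>\<^sup>2 \<le> G\<^sup>2"
        unfolding G_def using progress(1) \<epsilon> by (intro power_mono) auto
      then have "\<epsilon>\<^sup>2 \<le> \<rho> * (10 * \<Delta>)"
        using progress(3) unfolding \<Delta>_def G_def by (simp add: mult_ac)
      moreover have "0 < \<rho> * (10 * \<Delta>)"
        using calculation \<epsilon> by (meson less_le_trans zero_less_power)
      then have "0 < \<Delta>"
        using \<rho> by (simp add: zero_less_mult_iff)
      then have "\<rho> * (10 * \<Delta>) \<le> (4 * l) * (10 * \<Delta>)"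
        using \<rho> by (intro mult_right_mono) auto
      ultimately have "1 \<le> \<Delta> * (40 * l / \<epsilon>\<^sup>2)"
        using \<epsilon> by (simp add: field_simps)
      moreover have "(f x - fmin) * (40 * l / \<epsilon>\<^sup>2)
          = (f x' - fmin) * (40 * l / \<epsilon>\<^sup>2) - \<Delta> * (40 * l / \<epsilon>\<^sup>2)"
        unfolding \<Delta>_def by (simp add: left_diff_distrib diff_divide_distrib)
      ultimately have "(f x - fmin) * (40 * l / \<epsilon>\<^sup>2) + log 4 (4 * l / \<rho>) \<le> real n"
        using Suc.prems(6) by simp
      then obtain y N' where y: "NASCAR_loop A f \<epsilon> x \<rho> M (N + k + 1) = Some (y, N')"
        "norm (grad f y) \<le> \<epsilon>"
        and N': "real N' \<le> real (N + k + 1) + \<kappa> * (2 * sqrt 3) * sqrt (L / \<rho>) * (1 + log 2 (4 * G / \<epsilon>))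
             + \<kappa> * (120 * sqrt 3) * (sqrt (L * l) * (f x - fmin) / \<epsilon>\<^sup>2)"
        using Suc.IH[of \<rho> M x "N + k + 1"] M \<rho> progress(1) unfolding G_def by blast
      have "1 + log 2 (4 * G / \<epsilon>) \<le> 30 * \<rho> * \<Delta> / \<epsilon>\<^sup>2"
      proof -
        have "1 + log 2 (4 * (G / \<epsilon>)) \<le> 3 * (G / \<epsilon>)\<^sup>2"
          using progress(1) \<epsilon> unfolding G_def by (intro log_term_le_square) simp
        also have "\<dots> = 3 * G\<^sup>2 / \<epsilon>\<^sup>2"
          by (simp add: power_divide)
        also have "\<dots> \<le> 3 * (10 * \<rho> * \<Delta>) / \<epsilon>\<^sup>2"
          using progress(3) unfolding G_def \<Delta>_def by (intro divide_right_mono mult_left_mono) auto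
        finally show ?thesis by simp
      qed
      then have "\<kappa> * (2 * sqrt 3) * sqrt (L / \<rho>) * (1 + log 2 (4 * G / \<epsilon>))
          \<le> \<kappa> * (2 * sqrt 3) * sqrt (L / \<rho>) * (30 * \<rho> * \<Delta> / \<epsilon>\<^sup>2)"
        using \<open>0 \<le> \<kappa>\<close> \<open>0 < L\<close> \<rho> by (intro mult_left_mono mult_nonneg_nonneg) auto
      also have "\<dots> = \<kappa> * (60 * sqrt 3) * (sqrt (L / \<rho>) * \<rho>) * (\<Delta> / \<epsilon>\<^sup>2)"
        by simp
      also have "\<dots> \<le> \<kappa> * (60 * sqrt 3) * (2 * sqrt (L * l)) * (\<Delta> / \<epsilon>\<^sup>2)"
      proof -
        have "sqrt (L / \<rho>) * \<rho> = sqrt (L / \<rho> * \<rho>\<^sup>2)"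
          using \<rho>(1) by (simp only: real_sqrt_mult real_sqrt_abs abs_of_pos)
        also have "\<dots> = sqrt (L * \<rho>)"
          using \<rho> by (simp add: power2_eq_square)
        also have "\<dots> \<le> sqrt (2\<^sup>2 * (L * l))"
          using \<rho> \<open>0 < L\<close> by (intro real_sqrt_le_mono) simp
        also have "\<dots> = 2 * sqrt (L * l)"
          by (subst real_sqrt_mult) simp
        finally show ?thesis
          using \<open>0 \<le> \<kappa>\<close> \<open>0 < \<Delta>\<close> by (intro mult_right_mono mult_left_mono mult_nonneg_nonneg) auto
      qed
      also have "\<dots> = \<kappa> * (120 * sqrt 3) * (sqrt (L * l) * D / \<epsilon>\<^sup>2)
          - \<kappa> * (120 * sqrt 3) * (sqrt (L * l) * (f x - fmin) / \<epsilon>\<^sup>2)"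
      proof -
        define u where "u = f x - fmin"
        have "D = \<Delta> + u"
          unfolding D_def \<Delta>_def u_def by simp
        then show ?thesis
          unfolding u_def[symmetric] by (simp add: distrib_left add_divide_distrib)
      qed
      finally have "real N' \<le> real N + \<kappa> * (2 * sqrt 3) * sqrt (L / \<rho>) * \<tau>
             + \<kappa> * (120 * sqrt 3) * (sqrt (L * l) * D / \<epsilon>\<^sup>2)"
        using N' cost by simp
      then show ?thesis
        using y unfolding loop \<tau>_def D_def by blast
    qed
  qed
qed

theorem theorem7p2:
  fixes f :: "real ^ 'n \<Rightarrow> real"
    and A :: "(real ^ 'n) subroutine"
    and x0 xstar :: "real ^ 'n"
    and cA L l \<epsilon> l0 M0 :: real
  assumes subroutine: "subroutine_assumption cA A"
    and smooth: "smooth L f"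
    and curvature: "lower_curvature l f" "0 < l" "l \<le> L"
    and minimizer: "is_arg_min f (\<lambda>_. True) xstar"
    and eps: "\<epsilon> > 0"
    and start: "norm (grad f x0) > \<epsilon>"
    and l0: "0 < l0" "l0 \<le> l"
    and M0: "0 < M0" "M0 \<le> 4 * L"
  shows "\<exists>xhat N. NASCAR A f x0 \<epsilon> l0 M0 = Some (xhat, N) \<and>
           norm (grad f xhat) \<le> \<epsilon> \<and>
           real N \<le> 8 * sqrt 10 * C1 cA * sqrt (L / l0) * log 2 (4 * norm (grad f x0) / \<epsilon>)
                  + 160 * sqrt 10 * C1 cA * (sqrt (L * l) * (f x0 - f xstar) / \<epsilon>\<^sup>2)"
proof -
  define \<kappa> where "\<kappa> = (3 + 16 * sqrt (2 * cA)) * sqrt 10"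
  define \<tau> where "\<tau> = log 2 (4 * norm (grad f x0) / \<epsilon>)"
  define R where "R = sqrt (L * l) * (f x0 - f xstar) / \<epsilon>\<^sup>2"
  have lower: "f xstar \<le> f x" for x
    using minimizer by (auto simp: is_arg_min_def not_less)
  have "l0 < 4 * l" "M0 \<le> 4 * (L + 2 * l0)"
    using l0 M0 by auto
  from NASCAR_loop_correct[OF subroutine smooth curvature eps lower \<kappa>_def l0(1) this(1) M0(1) this(2) start, of 0]
  obtain xhat N where res: "NASCAR A f x0 \<epsilon> l0 M0 = Some (xhat, N)" "norm (grad f xhat) \<le> \<epsilon>"
    and N: "real N \<le> \<kappa> * (2 * sqrt 3) * sqrt (L / l0) * (1 + \<tau>) + \<kappa> * (120 * sqrt 3) * R"
    unfolding NASCAR_def \<tau>_def R_def by auto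
  have "0 \<le> \<kappa>"
    unfolding \<kappa>_def using subroutine_constant_nonneg[OF subroutine] by simp
  have "0 \<le> R"
    unfolding R_def using lower[of x0] curvature by simp
  have "2 \<le> \<tau>"
  proof -
    have "log 2 (2 ^ 2) \<le> log 2 (4 * norm (grad f x0) / \<epsilon>)"
      using start eps by (intro log_mono) (auto simp: field_simps)
    moreover have "log 2 (2 ^ 2) = (2 :: real)"
      by (subst log_pow_cancel) auto
    ultimately show ?thesis unfolding \<tau>_def by simp
  qed
  \<comment> \<open>The potential has the constants \<open>2 * sqrt 3\<close> and \<open>120 * sqrt 3\<close>; replacing \<open>sqrt 3\<close> by
    \<open>4 / 3 * sqrt 2\<close>, and \<open>1 + \<tau>\<close> by \<open>3 / 2 * \<tau>\<close>, gives at most \<open>8 * sqrt 2\<close> and \<open>160 * sqrt 2\<close>.\<close>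
  have sqrt3: "sqrt 3 \<le> 4 / 3 * sqrt 2"
    by (rule power2_le_imp_le) (simp_all add: power_mult_distrib power2_eq_square)
  have "\<kappa> * (2 * sqrt 3) * sqrt (L / l0) * (1 + \<tau>) \<le> \<kappa> * (2 * (4 / 3 * sqrt 2)) * sqrt (L / l0) * (3 / 2 * \<tau>)"
    using sqrt3 \<open>0 \<le> \<kappa>\<close> \<open>2 \<le> \<tau>\<close> l0 curvature by (intro mult_mono) auto
  also have "\<dots> \<le> \<kappa> * (8 * sqrt 2) * sqrt (L / l0) * \<tau>"
    using \<open>0 \<le> \<kappa>\<close> \<open>2 \<le> \<tau>\<close> l0 curvature by (simp add: mult_right_mono)
  finally have "real N \<le> \<kappa> * (8 * sqrt 2) * sqrt (L / l0) * \<tau> + \<kappa> * (120 * sqrt 3) * R"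
    using N by linarith
  moreover have "\<kappa> * (120 * sqrt 3) * R \<le> \<kappa> * (120 * (4 / 3 * sqrt 2)) * R"
    using sqrt3 \<open>0 \<le> \<kappa>\<close> \<open>0 \<le> R\<close> by (intro mult_right_mono mult_left_mono) auto
  ultimately have "real N \<le> \<kappa> * (8 * sqrt 2) * sqrt (L / l0) * \<tau> + \<kappa> * (120 * (4 / 3 * sqrt 2)) * R"
    by linarith
  also have "\<dots> = 8 * (\<kappa> * sqrt 2) * sqrt (L / l0) * \<tau> + 160 * (\<kappa> * sqrt 2) * R"
    by simp
  also have "\<kappa> * sqrt 2 = sqrt 10 * C1 cA"
    unfolding \<kappa>_def C1_def by simp
  finally have "real N \<le> 8 * sqrt 10 * C1 cA * sqrt (L / l0) * \<tau> + 160 * sqrt 10 * C1 cA * R"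
    by (simp only: mult.assoc)
  with res show ?thesis
    unfolding \<tau>_def R_def by blast
qed

end
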